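(* Let $n\ge2$, $\alpha\in(-n,0)$, and let $\phi$ be a Young function satisfying $\underline\Lambda_\phi(\alpha)<\infty$ and $\overline\Lambda_\phi(\alpha)<\infty$. Then a domain $\Omega\subset\mathbb R^n$ is globally $n$-regular if and only if there exists a constant $C\ge1$ such that: when $\operatorname{diam}\Omega<\infty$, $$\|u-u_\Omega\|_{L^{n/|\alpha|}(\Omega)}\le C\|u\|_{\dot{\mathbf B}^{\alpha,\phi}(\Omega)}\quad\forall u\in\dot{\mathbf B}^{\alpha,\phi}(\Omega);$$ and when $\operatorname{diam}\Omega=\infty$, $$\|u\|_{L^{n/|\alpha|}(\Omega)}\le C\|u\|_{\dot{\mathbf B}^{\alpha,\phi}(\Omega)}\quad\forall u\in\dot{\mathbf B}^{\alpha,\phi}(\Omega)\text{ having bounded support}.$$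
   Context: A Young function is $\phi\in C([0,\infty))$, convex, with $\phi(0)=0$, $\phi(t)>0$ for $t>0$ and $\lim_{t\to\infty}\phi(t)=\infty$. Define $\underline\Lambda_\phi(\alpha):=\sup_{x>0}\int_0^1\frac{\phi(t^{1-\alpha}x)}{\phi(x)}\frac{dt}{t^{n+1}}$ and $\overline\Lambda_\phi(\alpha):=\sup_{x>0}\int_1^\infty\frac{\phi(t^{-\alpha}x)}{\phi(x)}\frac{dt}{t^{n+1}}$. For a domain $\Omega$, $\dot{\mathbf B}^{\alpha,\phi}(\Omega)$ is the space of measurable $u$ on $\Omega$ with finite $\|u\|_{\dot{\mathbf B}^{\alpha,\phi}(\Omega)}:=\inf\{\lambda>0:\int_\Omega\int_\Omega\phi(\frac{|u(x)-u(y)|}{\lambda|x-y|^{\alpha}})\frac{dx\,dy}{|x-y|^{2n}}\le1\}$. $u_\Omega$ is the average of $u$ over $\Omega$. A domain $\Omega$ is globally $n$-regular if there is $\theta\in(0,1)$ with $|B(x,r)\cap\Omega|\ge\theta r^n$ for all $x\in\Omega$ and all $0<r<2\operatorname{diam}\Omega$. *)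

theory Defs
  imports "HOL-Analysis.Analysis"
begin

definition young_function :: "(real \<Rightarrow> real) \<Rightarrow> bool" where
  "young_function phi \<longleftrightarrow>
     continuous_on {0..} phi \<and> convex_on {0..} phi \<and> phi 0 = 0 \<and>
     (\<forall>t>0. phi t > 0) \<and> filterlim phi at_top at_top"

definition lower_Lambda :: "nat \<Rightarrow> (real \<Rightarrow> real) \<Rightarrow> real \<Rightarrow> ennreal" where
  "lower_Lambda n phi \<alpha> =
     (SUP x\<in>{0<..}. \<integral>\<^sup>+ t\<in>{0<..<1}.
        ennreal (phi (t powr (1 - \<alpha>) * x) / phi x / t ^ (n + 1)) \<partial>lborel)"

definition upper_Lambda :: "nat \<Rightarrow> (real \<Rightarrow> real) \<Rightarrow> real \<Rightarrow> ennreal" where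
  "upper_Lambda n phi \<alpha> =
     (SUP x\<in>{0<..}. \<integral>\<^sup>+ t\<in>{1<..}.
        ennreal (phi (t powr (- \<alpha>) * x) / phi x / t ^ (n + 1)) \<partial>lborel)"

definition is_domain :: "'a::euclidean_space set \<Rightarrow> bool" where
  "is_domain \<Omega> \<longleftrightarrow> open \<Omega> \<and> connected \<Omega> \<and> \<Omega> \<noteq> {}"

text \<open>Globally n-regular; for unbounded \<Omega> the diameter is \<infinity> so all r > 0 are allowed.\<close>
definition globally_regular :: "'a::euclidean_space set \<Rightarrow> bool" where
  "globally_regular \<Omega> \<longleftrightarrow>
     (\<exists>\<theta>. 0 < \<theta> \<and> \<theta> < 1 \<and>
        (\<forall>x\<in>\<Omega>. \<forall>r. 0 < r \<and> (bounded \<Omega> \<longrightarrow> r < 2 * diameter \<Omega>) \<longrightarrow>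
            measure lebesgue (ball x r \<inter> \<Omega>) \<ge> \<theta> * r ^ DIM('a)))"

definition besov_modular ::
  "real \<Rightarrow> (real \<Rightarrow> real) \<Rightarrow> 'a::euclidean_space set \<Rightarrow> ('a \<Rightarrow> real) \<Rightarrow> real \<Rightarrow> ennreal" where
  "besov_modular \<alpha> phi \<Omega> u lam =
     (\<integral>\<^sup>+ x\<in>\<Omega>. \<integral>\<^sup>+ y\<in>\<Omega>.
        ennreal (phi (\<bar>u x - u y\<bar> / (lam * norm (x - y) powr \<alpha>))
                 / norm (x - y) ^ (2 * DIM('a))) \<partial>lebesgue \<partial>lebesgue)"

definition besov_admissible ::
  "real \<Rightarrow> (real \<Rightarrow> real) \<Rightarrow> 'a::euclidean_space set \<Rightarrow> ('a \<Rightarrow> real) \<Rightarrow> real set" where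
  "besov_admissible \<alpha> phi \<Omega> u = {lam. lam > 0 \<and> besov_modular \<alpha> phi \<Omega> u lam \<le> 1}"

definition besov_norm ::
  "real \<Rightarrow> (real \<Rightarrow> real) \<Rightarrow> 'a::euclidean_space set \<Rightarrow> ('a \<Rightarrow> real) \<Rightarrow> real" where
  "besov_norm \<alpha> phi \<Omega> u = Inf (besov_admissible \<alpha> phi \<Omega> u)"

text \<open>Measurable functions on \<Omega> with finite Besov (Luxemburg) norm.\<close>
definition besov_space ::
  "real \<Rightarrow> (real \<Rightarrow> real) \<Rightarrow> 'a::euclidean_space set \<Rightarrow> ('a \<Rightarrow> real) set" where
  "besov_space \<alpha> phi \<Omega> =
     {u. u \<in> borel_measurable (restrict_space lebesgue \<Omega>) \<and> besov_admissible \<alpha> phi \<Omega> u \<noteq> {}}"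

definition Lp_norm :: "real \<Rightarrow> 'a::euclidean_space set \<Rightarrow> ('a \<Rightarrow> real) \<Rightarrow> ennreal" where
  "Lp_norm p \<Omega> f =
     (let I = \<integral>\<^sup>+ x\<in>\<Omega>. ennreal (\<bar>f x\<bar> powr p) \<partial>lebesgue
      in if I = \<infinity> then \<infinity> else ennreal (enn2real I powr (1 / p)))"

definition average :: "'a::euclidean_space set \<Rightarrow> ('a \<Rightarrow> real) \<Rightarrow> real" where
  "average \<Omega> u = (LINT x:\<Omega>|lebesgue. u x) / measure lebesgue \<Omega>"

end

theory Submission
  imports Defs "HOL-Probability.Distribution_Functions"
begin

text \<open>
  Put \<open>n = DIM('a)\<close> and \<open>q = n / \<bar>\<alpha>\<bar>\<close>. Finiteness of \<open>upper_Lambda\<close> gives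
  \<open>\<phi>(s x) \<le> K s\<^sup>q \<phi>(x)\<close> for \<open>s \<ge> 1\<close>, and makes \<open>\<phi>(s) / s\<^sup>q\<close> arbitrarily small
  for suitable large \<open>s\<close>.

  Regularity implies the embedding: let \<open>v \<ge> 0\<close> have modular at most \<open>1\<close> and be positive on at most half of
  \<open>\<Omega>\<close>, and let \<open>m k\<close> be the measure of the level set \<open>{v > 2\<^sup>k}\<close>. A point of that set sees, at
  distance comparable to the \<open>n\<close>-th root of \<open>m k\<close>, a set of measure at least \<open>m k\<close> on
  which \<open>v \<le> 2\<^sup>k\<close>. With \<open>b k = 2\<^sup>k (m k)\<^bsup>1/q\<^esup>\<close> this bounds
  \<open>\<Sum>k. m (k + 1) / m k * \<phi>(b k)\<close>; the growth of \<open>\<phi>\<close> turns this into a bound for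
  \<open>\<Sum>k. \<phi>(b k)\<close>, then for \<open>\<Sum>k. (b k)\<^sup>q\<close>, which is comparable to the integral of \<open>v\<^sup>q\<close>.
  It is applied to \<open>\<bar>u\<bar>\<close> if \<open>\<Omega>\<close> is unbounded, and to both parts of \<open>u\<close> minus a median if it is
  bounded; there the median may be replaced by the average because \<open>q \<ge> 1\<close>.

  The embedding implies regularity: a Lipschitz cutoff between the radii \<open>\<delta>\<close> and \<open>2 \<delta>\<close> has a modular
  controlled by \<open>lower_Lambda\<close> and \<open>upper_Lambda\<close>. If \<open>\<Omega>\<close> fills less than a small fraction
  \<open>\<epsilon>\<close> of \<open>ball x (2 \<delta>)\<close>, the embedding shows the same for \<open>ball x \<delta>\<close>, with the same \<open>\<epsilon>\<close>.
  Iterating contradicts that \<open>x\<close> is interior.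
\<close>

section \<open>Young functions\<close>

lemma young_zero: "young_function phi \<Longrightarrow> phi 0 = 0"
  by (simp add: young_function_def)

lemma young_pos: "young_function phi \<Longrightarrow> 0 < x \<Longrightarrow> 0 < phi x"
  by (simp add: young_function_def)

lemma young_nonneg: "young_function phi \<Longrightarrow> 0 \<le> x \<Longrightarrow> 0 \<le> phi x"
  by (cases "x = 0") (auto simp: young_zero young_pos less_imp_le)

lemma young_scale:
  assumes "young_function phi" "0 \<le> c" "c \<le> 1" "0 \<le> x"
  shows "phi (c * x) \<le> c * phi x"
proof -
  have "convex_on {0..} phi" using assms(1) by (simp add: young_function_def)
  from convex_onD[OF this, of c 0 x] show ?thesis
    using assms by (simp add: young_zero)
qed

lemma young_mono:
  assumes "young_function phi" "0 \<le> x" "x \<le> y"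
  shows "phi x \<le> phi y"
proof (cases "y = 0")
  case False
  with assms have y: "y > 0" by simp
  have "phi (x / y * y) \<le> x / y * phi y"
    using assms y by (intro young_scale) auto
  also have "\<dots> \<le> 1 * phi y"
    using assms y young_nonneg[of phi y] by (intro mult_right_mono) auto
  finally show ?thesis using y by simp
qed (use assms in simp)

lemma borel_measurable_young:
  assumes phi: "young_function phi" and f [measurable]: "f \<in> borel_measurable M"
    and nonneg: "\<And>x. x \<in> space M \<Longrightarrow> 0 \<le> f x"
  shows "(\<lambda>x. phi (f x)) \<in> borel_measurable M"
proof -
  have "continuous_on UNIV (\<lambda>t::real. phi \<bar>t\<bar>)"
    using phi by (intro continuous_on_compose2[of "{0..}" phi UNIV abs])
      (auto simp: young_function_def intro!: continuous_intros)
  then have "(\<lambda>x. phi \<bar>f x\<bar>) \<in> borel_measurable M"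
    by (rule borel_measurable_continuous_on) (rule f)
  then show ?thesis by (rule measurable_cong[THEN iffD1, rotated]) (simp add: nonneg)
qed

lemma sum_powi_two_le:
  fixes G :: "int set" and D :: real
  assumes "finite G" "\<And>k. k \<in> G \<Longrightarrow> 2 powi k \<le> D" "0 \<le> D"
  shows "(\<Sum>k\<in>G. 2 powi k) \<le> 2 * D"
  using assms
proof (induction G arbitrary: D rule: finite_linorder_max_induct)
  case (insert b A)
  have double: "2 * 2 powi (b - 1) = (2 powi b :: real)" by (simp add: power_int_diff)
  have "(\<Sum>k\<in>A. 2 powi k) \<le> 2 * (2 powi (b - 1) :: real)"
    using insert.hyps(2) by (intro insert.IH power_int_increasing) force+
  then have "(\<Sum>k\<in>insert b A. 2 powi k) \<le> 2 * (2 powi b :: real)"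
    unfolding double using insert.hyps by (subst sum.insert) auto
  also have "\<dots> \<le> 2 * D" using insert.prems(1)[of b] by simp
  finally show ?case .
qed simp

text \<open>Convexity makes the terms decay geometrically, so the largest one controls the sum.\<close>

lemma young_sum_dyadic_le:
  fixes G :: "int set" and D :: real
  assumes phi: "young_function phi" and G: "finite G" "\<And>k. k \<in> G \<Longrightarrow> 2 powi k \<le> D"
    and D: "0 \<le> D" and d: "0 \<le> d"
  shows "(\<Sum>k\<in>G. phi (2 powi k * d)) \<le> 2 * phi (D * d)"
proof (cases "D = 0")
  case True
  then have "G = {}" using G(2) zero_less_power_int[of "2::real"]
    by (metis all_not_in_conv not_le zero_less_numeral)
  then show ?thesis using True by (simp add: young_zero[OF phi])
next
  case False
  with D have D: "D > 0" by simp
  have "(\<Sum>k\<in>G. phi (2 powi k * d)) \<le> (\<Sum>k\<in>G. 2 powi k * (phi (D * d) / D))"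
  proof (rule sum_mono)
    fix k assume "k \<in> G"
    then have "phi (2 powi k / D * (D * d)) \<le> 2 powi k / D * phi (D * d)"
      using D d G(2) by (intro young_scale[OF phi]) auto
    then show "phi (2 powi k * d) \<le> 2 powi k * (phi (D * d) / D)" using D by simp
  qed
  also have "\<dots> = (\<Sum>k\<in>G. 2 powi k) * (phi (D * d) / D)" by (rule sum_distrib_right[symmetric])
  also have "\<dots> \<le> 2 * D * (phi (D * d) / D)"
    using D d young_nonneg[OF phi, of "D * d"] by (intro mult_right_mono sum_powi_two_le G) auto
  also have "\<dots> = 2 * phi (D * d)" using D by simp
  finally show ?thesis .
qed

section \<open>Growth of upper type\<close>

definition upper_type :: "(real \<Rightarrow> real) \<Rightarrow> real \<Rightarrow> real \<Rightarrow> bool" where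
  "upper_type phi q K \<longleftrightarrow> 1 \<le> K \<and> (\<forall>s\<ge>1. \<forall>x\<ge>0. phi (s * x) \<le> K * s powr q * phi x)"

lemma upper_typeD:
  assumes "upper_type phi q K"
  shows "1 \<le> K" and "1 \<le> s \<Longrightarrow> 0 \<le> x \<Longrightarrow> phi (s * x) \<le> K * s powr q * phi x"
  using assms by (auto simp: upper_type_def)

lemma upper_type_absorb:
  assumes phi: "young_function phi" and K: "upper_type phi q K" and \<rho>: "0 \<le> \<rho>" and x: "0 \<le> x"
  shows "phi (\<rho> * x) \<le> K * (2 * \<rho>) powr q * phi x + phi x / 2"
proof (cases "\<rho> \<le> 1 / 2")
  case True
  have "phi (\<rho> * x) \<le> \<rho> * phi x" using True \<rho> x by (intro young_scale[OF phi]) auto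
  also have "\<dots> \<le> 1 / 2 * phi x" using True young_nonneg[OF phi x] by (intro mult_right_mono) auto
  finally show ?thesis using young_nonneg[OF phi x] upper_typeD(1)[OF K] by (simp add: add_increasing)
next
  case False
  have "phi (\<rho> * x) \<le> phi (2 * \<rho> * x)"
    using \<rho> x by (intro young_mono[OF phi] mult_right_mono) auto
  also have "\<dots> \<le> K * (2 * \<rho>) powr q * phi x" using False x by (intro upper_typeD(2)[OF K]) auto
  finally show ?thesis using young_nonneg[OF phi x] by simp
qed

lemma powr_le_upper_type:
  assumes phi: "young_function phi" and K: "upper_type phi q K" and x: "0 \<le> x" "x \<le> B" and B: "0 < B"
  shows "x powr q \<le> K * B powr q / phi B * phi x"
proof (cases "x = 0")
  case True
  then show ?thesis by (simp add: young_zero[OF phi])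
next
  case False
  with x have x0: "x > 0" by simp
  have "phi (B / x * x) \<le> K * (B / x) powr q * phi x" using x x0 by (intro upper_typeD(2)[OF K]) auto
  then have "x powr q * phi B \<le> K * B powr q * phi x"
    using x0 B by (simp add: powr_divide field_simps)
  then show ?thesis using young_pos[OF phi B] by (simp add: field_simps)
qed

lemma set_nn_integral_le_upper_Lambda:
  "0 < x \<Longrightarrow> (\<integral>\<^sup>+ t\<in>{1<..}. ennreal (phi (t powr (- \<alpha>) * x) / phi x / t ^ (n + 1)) \<partial>lborel)
    \<le> upper_Lambda n phi \<alpha>"
  unfolding upper_Lambda_def by (intro SUP_upper) auto

lemma set_nn_integral_le_lower_Lambda:
  "0 < x \<Longrightarrow> (\<integral>\<^sup>+ t\<in>{0<..<1}. ennreal (phi (t powr (1 - \<alpha>) * x) / phi x / t ^ (n + 1)) \<partial>lborel)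
    \<le> lower_Lambda n phi \<alpha>"
  unfolding lower_Lambda_def by (intro SUP_upper) auto

lemma young_ratio_le_upper_Lambda:
  assumes phi: "young_function phi" and \<alpha>: "\<alpha> \<le> 0" and T: "1 \<le> T" and x: "0 < x"
  shows "ennreal (phi (T powr (- \<alpha>) * x) / phi x / (2 ^ (n + 1) * T ^ n)) \<le> upper_Lambda n phi \<alpha>"
proof -
  define c where "c = phi (T powr (- \<alpha>) * x) / phi x / (2 * T) ^ (n + 1)"
  have phi_x: "0 < phi x" and numerator: "0 \<le> phi (T powr (- \<alpha>) * x)"
    using phi x by (auto intro: young_pos young_nonneg)
  have c: "0 \<le> c" using T phi_x numerator by (simp add: c_def)
  have c_le: "c \<le> phi (t powr (- \<alpha>) * x) / phi x / t ^ (n + 1)" if "t \<in> {T<..2 * T}" for t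
    unfolding c_def using that T \<alpha> x phi_x numerator
    by (intro frac_le divide_right_mono divide_nonneg_pos young_nonneg[OF phi] young_mono[OF phi]
        mult_right_mono powr_mono2 power_mono) auto
  have "ennreal (phi (T powr (- \<alpha>) * x) / phi x / (2 ^ (n + 1) * T ^ n)) = ennreal (c * T)"
    using T by (simp add: c_def field_simps)
  also have "\<dots> = (\<integral>\<^sup>+ t. ennreal c * indicator {T<..2 * T} t \<partial>lborel)"
    using T c by (simp add: nn_integral_cmult_indicator ennreal_mult)
  also have "\<dots> \<le> (\<integral>\<^sup>+ t\<in>{1<..}. ennreal (phi (t powr (- \<alpha>) * x) / phi x / t ^ (n + 1)) \<partial>lborel)"
    using T c_le by (intro nn_integral_mono) (auto simp: indicator_def intro!: ennreal_leI)
  also have "\<dots> \<le> upper_Lambda n phi \<alpha>" by (rule set_nn_integral_le_upper_Lambda[OF x])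
  finally show ?thesis .
qed

lemma upper_type_if_upper_Lambda_finite:
  assumes phi: "young_function phi" and \<alpha>: "\<alpha> < 0" and up: "upper_Lambda n phi \<alpha> < \<infinity>"
  obtains K where "upper_type phi (real n / \<bar>\<alpha>\<bar>) K"
proof -
  obtain L where L: "upper_Lambda n phi \<alpha> = ennreal L" "0 \<le> L"
    using up by (cases "upper_Lambda n phi \<alpha>") auto
  define K where "K = max 1 (L * 2 ^ (n + 1))"
  have "phi (s * x) \<le> K * s powr (real n / \<bar>\<alpha>\<bar>) * phi x" if s: "1 \<le> s" and x: "0 \<le> x" for s x
  proof (cases "x = 0")
    case False
    with x have x: "0 < x" by simp
    define T where "T = s powr (1 / \<bar>\<alpha>\<bar>)"
    have T: "1 \<le> T" unfolding T_def using s by (intro ge_one_powr_ge_zero) auto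
    have T_powers: "T powr (- \<alpha>) = s" "T ^ n = s powr (real n / \<bar>\<alpha>\<bar>)"
      using s \<alpha> by (simp_all add: T_def powr_powr powr_realpow[symmetric])
    have "phi (s * x) / phi x / (2 ^ (n + 1) * T ^ n) \<le> L"
      using young_ratio_le_upper_Lambda[OF phi _ T x, of \<alpha> n] \<alpha> L by (simp add: T_powers(1))
    then have "phi (s * x) \<le> (L * 2 ^ (n + 1)) * T ^ n * phi x"
      using young_pos[OF phi x] T by (simp add: divide_le_eq mult_ac)
    also have "\<dots> \<le> K * T ^ n * phi x"
      using young_pos[OF phi x] T by (intro mult_right_mono) (auto simp: K_def)
    finally show ?thesis by (simp add: T_powers(2))
  qed (simp add: young_zero[OF phi])
  then have "upper_type phi (real n / \<bar>\<alpha>\<bar>) K" by (simp add: upper_type_def K_def)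
  then show thesis by (rule that)
qed

lemma set_nn_integral_inverse_at_top:
  fixes c T :: real
  assumes "0 < c" "0 < T"
  shows "(\<integral>\<^sup>+ t\<in>{T..}. ennreal (c / t) \<partial>lborel) = \<infinity>"
proof -
  have "ennreal (real N) \<le> (\<integral>\<^sup>+ t\<in>{T..}. ennreal (c / t) \<partial>lborel)" for N
  proof -
    define X where "X = T * exp (real N / c)"
    have X: "T \<le> X" using assms by (simp add: X_def)
    have "ennreal (real N) = ennreal (c * ln X - c * ln T)"
      using assms by (simp add: X_def ln_mult field_simps)
    also have "\<dots> = (\<integral>\<^sup>+ t. ennreal (c / t) * indicator {T..X} t \<partial>lborel)"
      using assms X by (intro nn_integral_FTC_Icc[symmetric]) (auto intro!: derivative_eq_intros)
    also have "\<dots> \<le> (\<integral>\<^sup>+ t\<in>{T..}. ennreal (c / t) \<partial>lborel)"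
      by (intro nn_integral_mono mult_left_mono) (auto simp: indicator_def)
    finally show ?thesis .
  qed
  then show ?thesis
    by (metis ennreal_Ex_less_of_nat ennreal_of_nat_eq_real_of_nat infinity_ennreal_def not_le
        top.not_eq_extremum)
qed

lemma exists_young_le_powr:
  assumes phi: "young_function phi" and \<alpha>: "\<alpha> < 0" and up: "upper_Lambda n phi \<alpha> < \<infinity>"
    and \<eta>: "0 < \<eta>" and s0: "1 \<le> s0"
  shows "\<exists>s\<ge>s0. phi s \<le> \<eta> * s powr (real n / \<bar>\<alpha>\<bar>)"
proof (rule ccontr)
  assume "\<not> ?thesis"
  then have large: "\<eta> * s powr (real n / \<bar>\<alpha>\<bar>) < phi s" if "s0 \<le> s" for s
    using that by (meson not_le)
  define T where "T = s0 powr (1 / \<bar>\<alpha>\<bar>) + 1"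
  have T: "1 < T" using s0 by (simp add: T_def)
  have "(\<integral>\<^sup>+ t\<in>{T..}. ennreal (\<eta> / phi 1 / t) \<partial>lborel)
    \<le> (\<integral>\<^sup>+ t\<in>{1<..}. ennreal (phi (t powr (- \<alpha>) * 1) / phi 1 / t ^ (n + 1)) \<partial>lborel)"
  proof (rule nn_integral_mono)
    fix t
    have "\<eta> / phi 1 / t \<le> phi (t powr (- \<alpha>)) / phi 1 / t ^ (n + 1)" if t: "T \<le> t"
    proof -
      have "s0 = (s0 powr (1 / \<bar>\<alpha>\<bar>)) powr (- \<alpha>)" using s0 \<alpha> by (simp add: powr_powr)
      also have "\<dots> \<le> t powr (- \<alpha>)" using t \<alpha> by (intro powr_mono2) (auto simp: T_def)
      finally have "\<eta> * (t powr (- \<alpha>)) powr (real n / \<bar>\<alpha>\<bar>) \<le> phi (t powr (- \<alpha>))"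
        using large by (simp add: less_imp_le)
      moreover have "(t powr (- \<alpha>)) powr (real n / \<bar>\<alpha>\<bar>) = t ^ n"
        using t T \<alpha> by (simp add: powr_powr powr_realpow)
      ultimately have "\<eta> * t ^ n / phi 1 / t ^ (n + 1) \<le> phi (t powr (- \<alpha>)) / phi 1 / t ^ (n + 1)"
        using t T young_pos[OF phi, of 1] by (intro divide_right_mono) auto
      then show ?thesis using t T by simp
    qed
    then show "ennreal (\<eta> / phi 1 / t) * indicator {T..} t
      \<le> ennreal (phi (t powr (- \<alpha>) * 1) / phi 1 / t ^ (n + 1)) * indicator {1<..} t"
      using T by (auto simp: indicator_def intro!: ennreal_leI)
  qed
  also have "\<dots> \<le> upper_Lambda n phi \<alpha>" by (rule set_nn_integral_le_upper_Lambda) simp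
  finally show False
    using up \<eta> T young_pos[OF phi, of 1] set_nn_integral_inverse_at_top[of "\<eta> / phi 1" T]
    by (simp add: top_unique)
qed

lemma exists_young_times_powr_small:
  assumes phi: "young_function phi" and \<alpha>: "\<alpha> < 0" and up: "upper_Lambda n phi \<alpha> < \<infinity>" and n: "0 < n"
    and C: "0 < C" and A: "0 \<le> A" and \<mu>: "0 < \<mu>"
  shows "\<exists>s>0. (C / s) powr (real n / \<bar>\<alpha>\<bar>) \<le> \<mu> \<and> A * (C / s) powr (real n / \<bar>\<alpha>\<bar>) * phi s \<le> 1"
proof -
  define q where "q = real n / \<bar>\<alpha>\<bar>"
  have q: "0 < q" using \<alpha> n by (auto simp: q_def divide_less_0_iff)
  define \<eta> where "\<eta> = 1 / (A * C powr q + 1)"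
  have \<eta>: "0 < \<eta>" "A * C powr q * \<eta> \<le> 1" using A by (simp_all add: \<eta>_def add_nonneg_pos)
  obtain s where s: "max 1 (C / \<mu> powr (1 / q)) \<le> s" and phi_s: "phi s \<le> \<eta> * s powr q"
    using exists_young_le_powr[OF phi \<alpha> up \<eta>(1), of "max 1 (C / \<mu> powr (1 / q))"] unfolding q_def by auto
  from s have s1: "1 \<le> s" by simp
  have "C / s \<le> \<mu> powr (1 / q)" using s \<mu> s1 by (simp add: field_simps)
  then have "(C / s) powr q \<le> (\<mu> powr (1 / q)) powr q" using C s1 q by (intro powr_mono2) auto
  then have small: "(C / s) powr q \<le> \<mu>" using \<mu> q by (simp add: powr_powr)
  have "A * (C / s) powr q * phi s \<le> A * (C / s) powr q * (\<eta> * s powr q)"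
    using A phi_s by (intro mult_left_mono) auto
  also have "\<dots> = A * C powr q * \<eta>" using s1 by (simp add: powr_divide)
  also note \<eta>(2)
  finally have "A * (C / s) powr q * phi s \<le> 1" .
  with small s1 show ?thesis unfolding q_def by (intro exI[of _ s]) simp
qed

section \<open>The Besov kernel\<close>

definition besov_kernel :: "real \<Rightarrow> (real \<Rightarrow> real) \<Rightarrow> real \<Rightarrow> 'a::euclidean_space \<Rightarrow> ennreal" where
  "besov_kernel \<alpha> phi h z = ennreal (phi (h * norm z powr (- \<alpha>)) / norm z ^ (2 * DIM('a)))"

lemma besov_modular_eq_kernel:
  "besov_modular \<alpha> phi \<Omega> u lam =
    (\<integral>\<^sup>+ x\<in>\<Omega>. \<integral>\<^sup>+ y\<in>\<Omega>. besov_kernel \<alpha> phi (\<bar>u x - u y\<bar> / lam) (x - y) \<partial>lebesgue \<partial>lebesgue)"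
proof -
  have "\<bar>u x - u y\<bar> / (lam * norm (x - y) powr \<alpha>) = \<bar>u x - u y\<bar> / lam * norm (x - y) powr (- \<alpha>)" for x y
    by (simp add: powr_minus divide_inverse)
  then show ?thesis by (simp only: besov_modular_def besov_kernel_def)
qed

lemma besov_kernel_zero: "young_function phi \<Longrightarrow> besov_kernel \<alpha> phi 0 z = 0"
  by (simp add: besov_kernel_def young_zero)

lemma besov_kernel_mono:
  assumes "young_function phi" "0 \<le> h" "h \<le> h'"
  shows "besov_kernel \<alpha> phi h z \<le> besov_kernel \<alpha> phi h' z"
  unfolding besov_kernel_def using assms
  by (intro ennreal_leI divide_right_mono young_mono[OF assms(1)] mult_right_mono) auto

lemma borel_measurable_besov_kernel:
  fixes g :: "'b \<Rightarrow> 'a::euclidean_space"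
  assumes phi: "young_function phi" and [measurable]: "f \<in> borel_measurable M" "g \<in> borel_measurable M"
    and f: "\<And>x. x \<in> space M \<Longrightarrow> 0 \<le> f x"
  shows "(\<lambda>x. besov_kernel \<alpha> phi (f x) (g x)) \<in> borel_measurable M"
proof -
  have [measurable]: "(\<lambda>x. phi (f x * norm (g x) powr (- \<alpha>))) \<in> borel_measurable M"
    by (rule borel_measurable_young[OF phi]) (measurable, simp add: f)
  show ?thesis unfolding besov_kernel_def by measurable
qed

lemma besov_modular_mono:
  assumes phi: "young_function phi" and lam: "0 < lam"
    and contraction: "\<And>x y. x \<in> \<Omega> \<Longrightarrow> y \<in> \<Omega> \<Longrightarrow> \<bar>v x - v y\<bar> \<le> \<bar>u x - u y\<bar>"
  shows "besov_modular \<alpha> phi \<Omega> v lam \<le> besov_modular \<alpha> phi \<Omega> u lam"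
proof -
  have "besov_kernel \<alpha> phi (\<bar>v x - v y\<bar> / lam) (x - y) \<le> besov_kernel \<alpha> phi (\<bar>u x - u y\<bar> / lam) (x - y)"
    if "x \<in> \<Omega>" "y \<in> \<Omega>" for x y
    using that lam by (intro besov_kernel_mono[OF phi] divide_right_mono contraction) auto
  then show ?thesis unfolding besov_modular_eq_kernel
    by (intro nn_integral_mono) (auto simp: indicator_def intro!: nn_integral_mono)
qed

lemma besov_modular_divide:
  "0 < lam \<Longrightarrow> besov_modular \<alpha> phi \<Omega> (\<lambda>x. u x / lam) 1 = besov_modular \<alpha> phi \<Omega> u lam"
  by (simp add: besov_modular_eq_kernel diff_divide_distrib[symmetric])

lemma sum_besov_kernel_separating_levels_le:
  fixes G :: "int set" and s t :: real and z :: "'a::euclidean_space"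
  assumes phi: "young_function phi" and G: "finite G"
    "\<And>k. k \<in> G \<Longrightarrow> 2 powi (k + 1) < s" "\<And>k. k \<in> G \<Longrightarrow> t \<le> 2 powi k"
  shows "(\<Sum>k\<in>G. besov_kernel \<alpha> phi (2 powi k) z) \<le> 2 * besov_kernel \<alpha> phi \<bar>s - t\<bar> z"
proof -
  let ?N = "norm z ^ (2 * DIM('a))"
  have level_le: "2 powi k \<le> \<bar>s - t\<bar>" if "k \<in> G" for k
    using G(2,3)[OF that] by (simp add: power_int_add)
  have "(\<Sum>k\<in>G. besov_kernel \<alpha> phi (2 powi k) z)
      = ennreal ((\<Sum>k\<in>G. phi (2 powi k * norm z powr (- \<alpha>))) / ?N)"
    using young_nonneg[OF phi] by (simp add: besov_kernel_def sum_divide_distrib)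
  also have "\<dots> \<le> ennreal (2 * phi (\<bar>s - t\<bar> * norm z powr (- \<alpha>)) / ?N)"
    by (intro ennreal_leI divide_right_mono young_sum_dyadic_le[OF phi G(1) level_le]) auto
  also have "\<dots> = 2 * besov_kernel \<alpha> phi \<bar>s - t\<bar> z"
    unfolding besov_kernel_def times_divide_eq_right[symmetric] by (subst ennreal_mult') simp_all
  finally show ?thesis .
qed

section \<open>Dyadic sums\<close>

lemma sum_le_if_half_absorbed:
  fixes a d :: "int \<Rightarrow> real"
  assumes a: "\<And>k. 0 \<le> a k" and step: "\<And>k. a (k + 1) \<le> d k + a k / 2"
    and d: "\<And>F. finite F \<Longrightarrow> sum d F \<le> c" and lim: "(\<lambda>n. a (- int n)) \<longlonglongrightarrow> 0" and F: "finite F"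
  shows "sum a F \<le> 2 * c"
proof -
  have interval: "sum a {m<..n} \<le> 2 * c + a m" if "m \<le> n" for m n
  proof -
    have "sum a {m<..n} = (\<Sum>k\<in>{m..<n}. a (k + 1))"
      by (rule sum.reindex_bij_witness[of _ "\<lambda>k. k + 1" "\<lambda>k. k - 1"]) auto
    also have "\<dots> \<le> (\<Sum>k\<in>{m..<n}. d k + a k / 2)" by (intro sum_mono step)
    also have "\<dots> = sum d {m..<n} + sum a {m..<n} / 2" by (simp add: sum.distrib sum_divide_distrib)
    also have "\<dots> \<le> c + sum a (insert m {m<..n}) / 2"
      using that a by (intro add_mono d divide_right_mono sum_mono2) auto
    finally show ?thesis by (simp add: field_simps)
  qed
  obtain N where N: "\<And>k. k \<in> F \<Longrightarrow> nat \<bar>k\<bar> < N"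
    using F finite_nat_set_iff_bounded[of "(\<lambda>k. nat \<bar>k\<bar>) ` F"] by auto
  have "sum a F \<le> 2 * c + a (- int n)" if "n \<ge> N" for n
  proof -
    have "F \<subseteq> {- int n<..int n}" using that N by fastforce
    then have "sum a F \<le> sum a {- int n<..int n}" using a by (intro sum_mono2) auto
    also have "\<dots> \<le> 2 * c + a (- int n)" by (rule interval) simp
    finally show ?thesis .
  qed
  moreover have "(\<lambda>n. 2 * c + a (- int n)) \<longlonglongrightarrow> 2 * c + 0" by (intro tendsto_intros lim)
  ultimately show ?thesis using LIMSEQ_le_const by fastforce
qed

lemma young_dyadic_step:
  assumes phi: "young_function phi" and q: "0 < q" and K: "upper_type phi q K"
    and m: "0 \<le> m" "0 \<le> m'" "m' \<le> m"
  shows "phi (2 powi (k + 1) * m' powr (1 / q))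
    \<le> K * 4 powr q * (m' / m * phi (2 powi k * m powr (1 / q))) + phi (2 powi k * m powr (1 / q)) / 2"
proof (cases "m = 0")
  case True
  then show ?thesis using m by (simp add: young_zero[OF phi])
next
  case False
  define \<rho> where "\<rho> = 2 * (m' / m) powr (1 / q)"
  have "2 * \<rho> = 4 * (m' / m) powr (1 / q)" by (simp add: \<rho>_def)
  then have \<rho>_powr: "(2 * \<rho>) powr q = 4 powr q * (m' / m)"
    using m q by (simp add: powr_mult powr_powr)
  have "2 powi (k + 1) * m' powr (1 / q) = \<rho> * (2 powi k * m powr (1 / q))"
    using m False by (simp add: \<rho>_def powr_divide power_int_add)
  moreover have "phi (\<rho> * (2 powi k * m powr (1 / q)))
      \<le> K * (2 * \<rho>) powr q * phi (2 powi k * m powr (1 / q)) + phi (2 powi k * m powr (1 / q)) / 2"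
    by (intro upper_type_absorb[OF phi K]) (simp_all add: \<rho>_def)
  ultimately show ?thesis by (simp add: \<rho>_powr mult.assoc)
qed

lemma sum_young_dyadic_le:
  fixes m :: "int \<Rightarrow> real"
  assumes phi: "young_function phi" and q: "0 < q" and K: "upper_type phi q K"
    and m: "\<And>k. 0 \<le> m k" "\<And>k. m (k + 1) \<le> m k" "\<And>k. m k \<le> A"
    and ratio_sum: "\<And>F. finite F \<Longrightarrow> (\<Sum>k\<in>F. m (k + 1) / m k * phi (2 powi k * m k powr (1 / q))) \<le> c"
    and F: "finite F"
  shows "(\<Sum>k\<in>F. phi (2 powi k * m k powr (1 / q))) \<le> 2 * (K * 4 powr q * c)"
proof (rule sum_le_if_half_absorbed[where a="\<lambda>k. phi (2 powi k * m k powr (1 / q))", OF _ _ _ _ F])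
  show "phi (2 powi (k + 1) * m (k + 1) powr (1 / q))
      \<le> K * 4 powr q * (m (k + 1) / m k * phi (2 powi k * m k powr (1 / q)))
        + phi (2 powi k * m k powr (1 / q)) / 2" for k
    by (rule young_dyadic_step[OF phi q K m(1,1,2)])
  have K0: "0 \<le> K * 4 powr q" using upper_typeD(1)[OF K] by simp
  show "(\<Sum>k\<in>F. K * 4 powr q * (m (k + 1) / m k * phi (2 powi k * m k powr (1 / q)))) \<le> K * 4 powr q * c"
    if "finite F" for F
    unfolding sum_distrib_left[symmetric] by (rule mult_left_mono[OF ratio_sum[OF that] K0])
  show nonneg: "0 \<le> phi (2 powi k * m k powr (1 / q))" for k by (intro young_nonneg[OF phi]) simp
  show "(\<lambda>n. phi (2 powi (- int n) * m (- int n) powr (1 / q))) \<longlonglongrightarrow> 0"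
  proof (rule tendsto_sandwich[of "\<lambda>_. 0", OF always_eventually always_eventually])
    show "\<forall>n. phi (2 powi (- int n) * m (- int n) powr (1 / q)) \<le> (1 / 2) ^ n * phi (A powr (1 / q))"
    proof
      fix n
      have half: "2 powi (- int n) = (1 / 2 :: real) ^ n"
        by (simp add: power_int_minus power_one_over inverse_eq_divide)
      have "phi (2 powi (- int n) * m (- int n) powr (1 / q)) \<le> phi ((1 / 2) ^ n * A powr (1 / q))"
        unfolding half using m q by (intro young_mono[OF phi] mult_left_mono powr_mono2) auto
      also have "\<dots> \<le> (1 / 2) ^ n * phi (A powr (1 / q))"
        by (intro young_scale[OF phi]) (auto intro: power_le_one)
      finally show "phi (2 powi (- int n) * m (- int n) powr (1 / q)) \<le> (1 / 2) ^ n * phi (A powr (1 / q))" .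
    qed
    show "(\<lambda>n. (1 / 2) ^ n * phi (A powr (1 / q))) \<longlonglongrightarrow> 0"
      by (intro tendsto_mult_left_zero LIMSEQ_realpow_zero) auto
  qed (use nonneg in auto)
qed

lemma sum_powr_le_if_sum_young_le:
  assumes phi: "young_function phi" and K: "upper_type phi q K" and c: "0 \<le> c"
  obtains C where "0 \<le> C"
    "\<And>(F :: 'i set) b. \<lbrakk>finite F; \<And>i. i \<in> F \<Longrightarrow> 0 \<le> b i; (\<Sum>i\<in>F. phi (b i)) \<le> c\<rbrakk>
      \<Longrightarrow> (\<Sum>i\<in>F. b i powr q) \<le> C"
proof -
  have "filterlim phi at_top at_top" using phi by (simp add: young_function_def)
  then have "eventually (\<lambda>x. c < phi x \<and> 0 < x) at_top"
    unfolding filterlim_at_top_dense using eventually_gt_at_top eventually_conj by blast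
  then obtain B where B: "c < phi B" "0 < B" by (auto simp: eventually_at_top_linorder)
  define D where "D = K * B powr q / phi B"
  have D: "0 \<le> D" using upper_typeD(1)[OF K] B c by (simp add: D_def)
  show thesis
  proof
    show "0 \<le> D * c" using D c by simp
    fix F :: "'i set" and b
    assume F: "finite F" and b: "\<And>i. i \<in> F \<Longrightarrow> 0 \<le> b i" and sum_phi: "(\<Sum>i\<in>F. phi (b i)) \<le> c"
    have "b i powr q \<le> D * phi (b i)" if "i \<in> F" for i
    proof -
      have "phi (b i) \<le> (\<Sum>i\<in>F. phi (b i))"
        using that F b young_nonneg[OF phi] by (intro member_le_sum) auto
      with sum_phi B have "phi (b i) < phi B" by linarith
      then have "b i \<le> B" using young_mono[OF phi, of B "b i"] B by linarith
      then show ?thesis unfolding D_def using that b B by (intro powr_le_upper_type[OF phi K]) auto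
    qed
    then have "(\<Sum>i\<in>F. b i powr q) \<le> D * (\<Sum>i\<in>F. phi (b i))"
      unfolding sum_distrib_left by (rule sum_mono)
    also have "\<dots> \<le> D * c" by (rule mult_left_mono[OF sum_phi D])
    finally show "(\<Sum>i\<in>F. b i powr q) \<le> D * c" .
  qed
qed

lemma nn_integral_count_space_le_if_finite_sums_le:
  fixes f :: "'a \<Rightarrow> ennreal"
  assumes A: "countable A" and sum_le: "\<And>F. finite F \<Longrightarrow> F \<subseteq> A \<Longrightarrow> sum f F \<le> c"
  shows "(\<integral>\<^sup>+ k. f k \<partial>count_space A) \<le> c"
proof (cases "finite A")
  case True
  then show ?thesis using sum_le[of A] by (simp add: nn_integral_count_space_finite)
next
  case False
  let ?g = "from_nat_into A"
  have bij: "bij_betw ?g UNIV A" by (rule bij_betw_from_nat_into[OF A False])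
  have "(\<integral>\<^sup>+ k. f k \<partial>count_space A) = (\<Sum>n. f (?g n))"
    using nn_integral_bij_count_space[OF bij, of f] by (simp add: nn_integral_count_space_nat)
  also have "\<dots> \<le> c"
  proof (rule suminf_le_const[OF summableI])
    fix n
    have "(\<Sum>i<n. f (?g i)) = sum f (?g ` {..<n})"
      using bij by (subst sum.reindex) (auto simp: bij_betw_def intro: inj_on_subset)
    also have "\<dots> \<le> c" using bij by (intro sum_le) (auto simp: bij_betw_def)
    finally show "(\<Sum>i<n. f (?g i)) \<le> c" .
  qed
  finally show ?thesis .
qed

lemma dyadic_level_exists:
  fixes t :: real
  assumes "0 < t"
  obtains k :: int where "2 powi k < t" "t \<le> 2 powi (k + 1)"
proof
  have powi: "2 powi k = 2 powr real_of_int k" for k by (simp add: powr_real_of_int')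
  show "2 powi (\<lceil>log 2 t\<rceil> - 1) < t" "t \<le> 2 powi (\<lceil>log 2 t\<rceil> - 1 + 1)"
    using assms by (simp_all add: powi less_log_iff[symmetric] log_le_iff[symmetric]) linarith
qed

lemma nn_integral_powr_le_dyadic_levels:
  fixes f :: "'a \<Rightarrow> real"
  assumes [measurable]: "f \<in> borel_measurable M" and f: "\<And>x. x \<in> space M \<Longrightarrow> 0 \<le> f x" and q: "0 \<le> q"
  shows "(\<integral>\<^sup>+ x. ennreal (f x powr q) \<partial>M) \<le> ennreal (2 powr q) *
    (\<integral>\<^sup>+ k. ennreal ((2 powi k) powr q) * emeasure M {x\<in>space M. 2 powi k < f x}
      \<partial>count_space (UNIV :: int set))"
proof -
  define g where "g k x = ennreal (2 powr q * (2 powi k) powr q)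
      * indicator {x\<in>space M. 2 powi k < f x} x" for k :: int and x
  have g: "g k \<in> borel_measurable M" for k unfolding g_def by measurable
  have "(\<integral>\<^sup>+ x. ennreal (f x powr q) \<partial>M) \<le> (\<integral>\<^sup>+ x. (\<integral>\<^sup>+ k. g k x \<partial>count_space UNIV) \<partial>M)"
  proof (rule nn_integral_mono)
    fix x assume x: "x \<in> space M"
    show "ennreal (f x powr q) \<le> (\<integral>\<^sup>+ k. g k x \<partial>count_space UNIV)"
    proof (cases "f x = 0")
      case False
      with f x have "0 < f x" by (simp add: less_le)
      then obtain k :: int where k: "2 powi k < f x" "f x \<le> 2 powi (k + 1)" by (rule dyadic_level_exists)
      have "f x powr q \<le> (2 * 2 powi k) powr q"
        using k f x q by (intro powr_mono2) (auto simp: power_int_add mult.commute)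
      then have "ennreal (f x powr q) \<le> g k x"
        using k x by (simp add: g_def powr_mult ennreal_leI)
      also have "\<dots> \<le> (\<integral>\<^sup>+ k. g k x \<partial>count_space UNIV)" by (rule nn_integral_ge_point) simp
      finally show ?thesis .
    qed simp
  qed
  also have "\<dots> = (\<integral>\<^sup>+ k. (\<integral>\<^sup>+ x. g k x \<partial>M) \<partial>count_space UNIV)"
    by (rule nn_integral_count_space_nn_integral) (simp_all add: g)
  also have "\<dots> = (\<integral>\<^sup>+ k. ennreal (2 powr q) *
      (ennreal ((2 powi k) powr q) * emeasure M {x\<in>space M. 2 powi k < f x}) \<partial>count_space UNIV)"
    unfolding g_def
    by (intro nn_integral_cong, subst nn_integral_cmult_indicator)
      (measurable, simp add: ennreal_mult mult.assoc)
  also have "\<dots> = ennreal (2 powr q) *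
      (\<integral>\<^sup>+ k. ennreal ((2 powi k) powr q) * emeasure M {x\<in>space M. 2 powi k < f x} \<partial>count_space UNIV)"
    by (rule nn_integral_cmult) simp
  finally show ?thesis .
qed

section \<open>Superlevel sets\<close>

definition superlevel :: "'a set \<Rightarrow> ('a \<Rightarrow> real) \<Rightarrow> real \<Rightarrow> 'a set" where
  "superlevel \<Omega> v t = {x\<in>\<Omega>. t < v x}"

lemma superlevel_antimono: "s \<le> t \<Longrightarrow> superlevel \<Omega> v t \<subseteq> superlevel \<Omega> v s"
  by (auto simp: superlevel_def)

lemma sets_superlevel:
  assumes \<Omega>: "\<Omega> \<in> sets lebesgue" and [measurable]: "v \<in> borel_measurable (lebesgue_on \<Omega>)"
  shows "superlevel \<Omega> v t \<in> sets lebesgue"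
proof -
  have "{x\<in>space (lebesgue_on \<Omega>). t < v x} \<in> sets (lebesgue_on \<Omega>)" by measurable
  then show ?thesis using \<Omega> by (simp add: superlevel_def sets_restrict_space_iff)
qed

lemma lmeasurable_superlevel:
  assumes "\<Omega> \<in> sets lebesgue" "v \<in> borel_measurable (lebesgue_on \<Omega>)" "superlevel \<Omega> v s \<in> lmeasurable" "s \<le> t"
  shows "superlevel \<Omega> v t \<in> lmeasurable"
  using assms by (intro fmeasurableI2[OF assms(3)] superlevel_antimono sets_superlevel)

lemma sum_besov_kernel_levels_le:
  fixes \<Omega> :: "'a::euclidean_space set" and G :: "int set"
  assumes phi: "young_function phi" and G: "finite G" "\<And>k. k \<in> G \<Longrightarrow> x \<in> superlevel \<Omega> v (2 powi (k + 1))"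
  shows "(\<Sum>k\<in>G. besov_kernel \<alpha> phi (2 powi k) (x - y) * indicator (\<Omega> - superlevel \<Omega> v (2 powi k)) y)
    \<le> 2 * (besov_kernel \<alpha> phi \<bar>v x - v y\<bar> (x - y) * indicator \<Omega> y)"
proof (cases "y \<in> \<Omega>")
  case True
  let ?low = "\<lambda>k. y \<in> \<Omega> - superlevel \<Omega> v (2 powi k)"
  have "(\<Sum>k\<in>G. besov_kernel \<alpha> phi (2 powi k) (x - y) * indicator (\<Omega> - superlevel \<Omega> v (2 powi k)) y)
      = (\<Sum>k\<in>{k\<in>G. ?low k}. besov_kernel \<alpha> phi (2 powi k) (x - y))"
    unfolding sum.inter_filter[OF G(1)] by (intro sum.cong refl) (simp add: indicator_def)
  also have "\<dots> \<le> 2 * besov_kernel \<alpha> phi \<bar>v x - v y\<bar> (x - y)"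
  proof (rule sum_besov_kernel_separating_levels_le[OF phi])
    show "finite {k\<in>G. ?low k}" using G(1) by simp
  qed (use True G(2) in \<open>auto simp: superlevel_def\<close>)
  finally show ?thesis using True by simp
qed simp

lemma besov_kernel_integral_ge_levels:
  fixes \<Omega> :: "'a::euclidean_space set" and F :: "int set"
  assumes phi: "young_function phi" and \<Omega>: "\<Omega> \<in> sets lebesgue" and v: "v \<in> borel_measurable (lebesgue_on \<Omega>)"
    and F: "finite F"
    and c: "\<And>k. k \<in> F \<Longrightarrow> x \<in> superlevel \<Omega> v (2 powi (k + 1)) \<Longrightarrow>
      2 * c k \<le> (\<integral>\<^sup>+ y\<in>\<Omega> - superlevel \<Omega> v (2 powi k). besov_kernel \<alpha> phi (2 powi k) (x - y) \<partial>lebesgue)"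
  shows "(\<Sum>k\<in>F. c k * indicator (superlevel \<Omega> v (2 powi (k + 1))) x)
    \<le> (\<integral>\<^sup>+ y\<in>\<Omega>. besov_kernel \<alpha> phi \<bar>v x - v y\<bar> (x - y) \<partial>lebesgue)"
proof -
  let ?B = "\<lambda>k. \<Omega> - superlevel \<Omega> v (2 powi k)"
  define G where "G = {k\<in>F. x \<in> superlevel \<Omega> v (2 powi (k + 1))}"
  have G: "finite G" using F by (simp add: G_def)
  have diff: "(\<lambda>y. x - y) \<in> borel_measurable lebesgue" by (rule measurable_completion) simp
  have "(\<lambda>y. besov_kernel \<alpha> phi \<bar>v x - v y\<bar> (x - y)) \<in> borel_measurable (lebesgue_on \<Omega>)"
    using v by (intro borel_measurable_besov_kernel[OF phi] measurable_restrict_space1[OF diff]) auto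
  then have kernel: "(\<lambda>y. besov_kernel \<alpha> phi \<bar>v x - v y\<bar> (x - y) * indicator \<Omega> y) \<in> borel_measurable lebesgue"
    using \<Omega> by (simp add: borel_measurable_restrict_space_iff_ennreal)
  have "2 * (\<Sum>k\<in>F. c k * indicator (superlevel \<Omega> v (2 powi (k + 1))) x) = (\<Sum>k\<in>G. 2 * c k)"
    unfolding G_def sum_distrib_left sum.inter_filter[OF F]
    by (intro sum.cong refl) (simp add: indicator_def)
  also have "\<dots> \<le> (\<Sum>k\<in>G. \<integral>\<^sup>+ y\<in>?B k. besov_kernel \<alpha> phi (2 powi k) (x - y) \<partial>lebesgue)"
    by (intro sum_mono c) (auto simp: G_def)
  also have "\<dots> = (\<integral>\<^sup>+ y. (\<Sum>k\<in>G. besov_kernel \<alpha> phi (2 powi k) (x - y) * indicator (?B k) y) \<partial>lebesgue)"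
    using \<Omega> by (intro nn_integral_sum[symmetric] borel_measurable_times_ennreal borel_measurable_indicator
      borel_measurable_besov_kernel[OF phi] sets.Diff sets_superlevel[OF \<Omega> v] diff) auto
  also have "\<dots> \<le> (\<integral>\<^sup>+ y. 2 * (besov_kernel \<alpha> phi \<bar>v x - v y\<bar> (x - y) * indicator \<Omega> y) \<partial>lebesgue)"
    by (intro nn_integral_mono sum_besov_kernel_levels_le[OF phi G]) (simp add: G_def)
  also have "\<dots> = 2 * (\<integral>\<^sup>+ y\<in>\<Omega>. besov_kernel \<alpha> phi \<bar>v x - v y\<bar> (x - y) \<partial>lebesgue)"
    by (rule nn_integral_cmult[OF kernel])
  finally show ?thesis by (simp add: ennreal_mult_le_mult_iff)
qed

lemma besov_modular_ge_levels:
  fixes \<Omega> :: "'a::euclidean_space set" and F :: "int set"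
  assumes phi: "young_function phi" and \<Omega>: "\<Omega> \<in> sets lebesgue" and v: "v \<in> borel_measurable (lebesgue_on \<Omega>)"
    and F: "finite F"
    and c: "\<And>k x. k \<in> F \<Longrightarrow> x \<in> superlevel \<Omega> v (2 powi (k + 1)) \<Longrightarrow>
      2 * c k \<le> (\<integral>\<^sup>+ y\<in>\<Omega> - superlevel \<Omega> v (2 powi k). besov_kernel \<alpha> phi (2 powi k) (x - y) \<partial>lebesgue)"
  shows "(\<Sum>k\<in>F. c k * emeasure lebesgue (superlevel \<Omega> v (2 powi (k + 1)))) \<le> besov_modular \<alpha> phi \<Omega> v 1"
proof -
  let ?A = "\<lambda>k. superlevel \<Omega> v (2 powi (k + 1))"
  have "(\<Sum>k\<in>F. c k * emeasure lebesgue (?A k)) = (\<integral>\<^sup>+ x. (\<Sum>k\<in>F. c k * indicator (?A k) x) \<partial>lebesgue)"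
    using sets_superlevel[OF \<Omega> v] by (subst nn_integral_sum) (auto simp: nn_integral_cmult_indicator)
  also have "\<dots> \<le> besov_modular \<alpha> phi \<Omega> v 1"
    unfolding besov_modular_eq_kernel
  proof (rule nn_integral_mono)
    fix x
    show "(\<Sum>k\<in>F. c k * indicator (?A k) x)
      \<le> (\<integral>\<^sup>+ y\<in>\<Omega>. besov_kernel \<alpha> phi (\<bar>v x - v y\<bar> / 1) (x - y) \<partial>lebesgue) * indicator \<Omega> x"
      using besov_kernel_integral_ge_levels[OF phi \<Omega> v F c]
      by (cases "x \<in> \<Omega>") (auto simp: superlevel_def)
  qed
  finally show ?thesis .
qed

section \<open>The measure density condition\<close>

definition measure_density_condition :: "real \<Rightarrow> 'a::euclidean_space set \<Rightarrow> bool" where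
  "measure_density_condition \<theta> \<Omega> \<longleftrightarrow> (\<forall>x\<in>\<Omega>. \<forall>r>0.
     min (ennreal (\<theta> * r ^ DIM('a))) (emeasure lebesgue \<Omega>) \<le> emeasure lebesgue (ball x r \<inter> \<Omega>))"

lemma measure_density_ball_Diff_ge:
  fixes \<Omega> A :: "'a::euclidean_space set"
  assumes dens: "measure_density_condition \<theta> \<Omega>" and sets: "\<Omega> \<in> sets lebesgue" "A \<in> lmeasurable"
    and half: "2 * emeasure lebesgue A \<le> emeasure lebesgue \<Omega>"
    and x: "x \<in> \<Omega>" and r: "0 < r" "\<theta> * r ^ DIM('a) = 2 * measure lebesgue A"
  shows "emeasure lebesgue A \<le> emeasure lebesgue (ball x r \<inter> \<Omega> - A)"
proof -
  have A: "emeasure lebesgue A = ennreal (measure lebesgue A)" by (rule emeasure_eq_measure2[OF sets(2)])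
  have "2 * emeasure lebesgue A = ennreal (\<theta> * r ^ DIM('a))" by (simp add: A r ennreal_mult)
  then have "2 * emeasure lebesgue A = min (ennreal (\<theta> * r ^ DIM('a))) (emeasure lebesgue \<Omega>)"
    using half by simp
  also have "\<dots> \<le> emeasure lebesgue (ball x r \<inter> \<Omega>)"
    using dens x r(1) by (simp add: measure_density_condition_def)
  also have "\<dots> \<le> emeasure lebesgue ((ball x r \<inter> \<Omega> - A) \<union> A)"
    using sets by (intro emeasure_mono sets.Un sets.Diff sets.Int) auto
  also have "\<dots> \<le> emeasure lebesgue (ball x r \<inter> \<Omega> - A) + emeasure lebesgue A"
    using sets by (intro emeasure_subadditive sets.Diff sets.Int) auto
  finally show ?thesis by (simp add: mult_2 A ennreal_add_left_cancel_le add.commute)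
qed

lemma besov_kernel_ge:
  fixes z :: "'a::euclidean_space"
  assumes phi: "young_function phi" and \<alpha>: "\<alpha> < 0" and K: "upper_type phi (real DIM('a) / \<bar>\<alpha>\<bar>) K"
    and h: "0 \<le> h" and z: "z \<noteq> 0" "norm z \<le> r"
  shows "ennreal (phi (h * r powr (- \<alpha>)) / (K * r ^ (2 * DIM('a)))) \<le> besov_kernel \<alpha> phi h z"
proof -
  let ?n = "DIM('a)"
  define s where "s = norm z"
  have s: "0 < s" "s \<le> r" using z by (auto simp: s_def)
  have K1: "1 \<le> K" by (rule upper_typeD(1)[OF K])
  have "phi (h * r powr (- \<alpha>)) = phi ((r / s) powr (- \<alpha>) * (h * s powr (- \<alpha>)))"
    using s by (simp add: powr_divide mult.commute)
  also have "\<dots> \<le> K * ((r / s) powr (- \<alpha>)) powr (real ?n / \<bar>\<alpha>\<bar>) * phi (h * s powr (- \<alpha>))"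
    using s \<alpha> h by (intro upper_typeD(2)[OF K] ge_one_powr_ge_zero) auto
  also have "((r / s) powr (- \<alpha>)) powr (real ?n / \<bar>\<alpha>\<bar>) = (r / s) ^ ?n"
    using s \<alpha> by (simp add: powr_powr powr_realpow)
  finally have "phi (h * r powr (- \<alpha>)) / (K * r ^ (2 * ?n))
      \<le> (r / s) ^ ?n * phi (h * s powr (- \<alpha>)) / r ^ (2 * ?n)"
    using K1 s by (simp add: field_simps)
  also have "\<dots> = phi (h * s powr (- \<alpha>)) / (s ^ ?n * r ^ ?n)"
    using s by (simp add: power_divide mult_2 power_add)
  also have "\<dots> \<le> phi (h * s powr (- \<alpha>)) / (s ^ ?n * s ^ ?n)"
    using s young_nonneg[OF phi, of "h * s powr (- \<alpha>)"] h
    by (intro divide_left_mono mult_left_mono power_mono) auto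
  also have "s ^ ?n * s ^ ?n = s ^ (2 * ?n)" by (simp add: mult_2 power_add)
  finally show ?thesis unfolding besov_kernel_def s_def by (rule ennreal_leI)
qed

lemma besov_kernel_integral_Diff_ge:
  fixes \<Omega> A :: "'a::euclidean_space set"
  assumes phi: "young_function phi" and \<alpha>: "\<alpha> < 0" and K: "upper_type phi (real DIM('a) / \<bar>\<alpha>\<bar>) K"
    and \<theta>: "0 < \<theta>" "\<theta> \<le> 1" and dens: "measure_density_condition \<theta> \<Omega>"
    and sets: "\<Omega> \<in> sets lebesgue" "A \<in> lmeasurable" "A \<subseteq> \<Omega>"
    and half: "2 * emeasure lebesgue A \<le> emeasure lebesgue \<Omega>"
    and x: "x \<in> A" and h: "0 \<le> h" and M: "M = measure lebesgue A"
  shows "ennreal (\<theta>\<^sup>2 / (4 * K) * phi (h * M powr (\<bar>\<alpha>\<bar> / real DIM('a))) / M)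
    \<le> (\<integral>\<^sup>+ y\<in>\<Omega> - A. besov_kernel \<alpha> phi h (x - y) \<partial>lebesgue)"
proof (cases "M = 0")
  case False
  let ?n = "DIM('a)"
  have M0: "0 < M" using False by (simp add: M zero_less_measure_iff)
  have K1: "1 \<le> K" by (rule upper_typeD(1)[OF K])
  define r where "r = (2 * M / \<theta>) powr (1 / real ?n)"
  have r: "0 < r" using M0 \<theta> by (simp add: r_def)
  have r_pow: "r ^ ?n = 2 * M / \<theta>"
    using M0 \<theta> r by (simp add: powr_realpow[symmetric]) (simp add: r_def powr_powr)
  have "M * \<theta> \<le> M * 2" using M0 \<theta> by (intro mult_left_mono) auto
  then have "M powr (\<bar>\<alpha>\<bar> / real ?n) \<le> (2 * M / \<theta>) powr (\<bar>\<alpha>\<bar> / real ?n)"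
    using M0 \<theta> by (intro powr_mono2) (auto simp: le_divide_eq)
  also have "\<dots> = r powr (- \<alpha>)" using \<alpha> by (simp add: r_def powr_powr)
  finally have M_powr: "M powr (\<bar>\<alpha>\<bar> / real ?n) \<le> r powr (- \<alpha>)" .
  define c where "c = phi (h * r powr (- \<alpha>)) / (K * r ^ (2 * ?n))"
  have c: "0 \<le> c" using young_nonneg[OF phi, of "h * r powr (- \<alpha>)"] h K1 r by (simp add: c_def)
  have "\<theta>\<^sup>2 / (4 * K) * phi (h * M powr (\<bar>\<alpha>\<bar> / real ?n)) / M \<le> \<theta>\<^sup>2 / (4 * K) * phi (h * r powr (- \<alpha>)) / M"
    using \<theta> K1 M0 h M_powr by (intro divide_right_mono mult_left_mono young_mono[OF phi]) auto
  also have "\<dots> = c * M"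
    using M0 \<theta> K1 by (simp add: c_def power_mult mult.commute[of 2] r_pow power2_eq_square field_simps)
  finally have "ennreal (\<theta>\<^sup>2 / (4 * K) * phi (h * M powr (\<bar>\<alpha>\<bar> / real ?n)) / M)
      \<le> ennreal c * emeasure lebesgue A"
    using c M0 by (simp add: emeasure_eq_measure2[OF sets(2)] M ennreal_mult[symmetric] ennreal_leI)
  also have "\<dots> \<le> ennreal c * emeasure lebesgue (ball x r \<inter> \<Omega> - A)"
    using x sets(3) \<theta> r_pow
    by (intro mult_left_mono measure_density_ball_Diff_ge[OF dens sets(1,2) half _ r]) (auto simp: M)
  also have "\<dots> = (\<integral>\<^sup>+ y. ennreal c * indicator (ball x r \<inter> \<Omega> - A) y \<partial>lebesgue)"
    using sets by (intro nn_integral_cmult_indicator[symmetric] sets.Diff sets.Int) auto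
  also have "\<dots> \<le> (\<integral>\<^sup>+ y\<in>\<Omega> - A. besov_kernel \<alpha> phi h (x - y) \<partial>lebesgue)"
  proof (rule nn_integral_mono)
    fix y
    have "ennreal c \<le> besov_kernel \<alpha> phi h (x - y)" if "y \<in> ball x r - A"
      unfolding c_def using that x h by (intro besov_kernel_ge[OF phi \<alpha> K]) (auto simp: dist_norm)
    then show "ennreal c * indicator (ball x r \<inter> \<Omega> - A) y
        \<le> besov_kernel \<alpha> phi h (x - y) * indicator (\<Omega> - A) y"
      by (simp add: indicator_def)
  qed
  finally show ?thesis .
qed simp

lemma measure_density_level_ratio_sum_le:
  fixes \<Omega> :: "'a::euclidean_space set" and v :: "'a \<Rightarrow> real" and F :: "int set"
  assumes phi: "young_function phi" and \<alpha>: "\<alpha> < 0" and K: "upper_type phi (real DIM('a) / \<bar>\<alpha>\<bar>) K"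
    and \<theta>: "0 < \<theta>" "\<theta> \<le> 1" and dens: "measure_density_condition \<theta> \<Omega>"
    and \<Omega>: "\<Omega> \<in> sets lebesgue" and v: "v \<in> borel_measurable (lebesgue_on \<Omega>)"
    and fin: "\<And>k. superlevel \<Omega> v (2 powi k) \<in> lmeasurable"
    and half: "\<And>k. 2 * emeasure lebesgue (superlevel \<Omega> v (2 powi k)) \<le> emeasure lebesgue \<Omega>"
    and modular: "besov_modular \<alpha> phi \<Omega> v 1 \<le> 1" and F: "finite F"
  defines "m \<equiv> \<lambda>k::int. measure lebesgue (superlevel \<Omega> v (2 powi k))"
  shows "(\<Sum>k\<in>F. m (k + 1) / m k * phi (2 powi k * m k powr (\<bar>\<alpha>\<bar> / real DIM('a)))) \<le> 8 * K / \<theta>\<^sup>2"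
proof -
  have K1: "1 \<le> K" by (rule upper_typeD(1)[OF K])
  have m: "0 \<le> m k" "emeasure lebesgue (superlevel \<Omega> v (2 powi k)) = ennreal (m k)" for k
    by (simp_all add: m_def emeasure_eq_measure2[OF fin])
  define \<phi> where "\<phi> k = phi (2 powi k * m k powr (\<bar>\<alpha>\<bar> / real DIM('a)))" for k
  have \<phi>: "0 \<le> \<phi> k" for k using young_nonneg[OF phi] by (simp add: \<phi>_def)
  have "ennreal (\<Sum>k\<in>F. \<theta>\<^sup>2 / (8 * K) * \<phi> k / m k * m (k + 1))
      = (\<Sum>k\<in>F. ennreal (\<theta>\<^sup>2 / (8 * K) * \<phi> k / m k) * emeasure lebesgue (superlevel \<Omega> v (2 powi (k + 1))))"
    using K1 \<phi> m(1) by (simp add: m(2) ennreal_mult[symmetric])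
  also have "\<dots> \<le> besov_modular \<alpha> phi \<Omega> v 1"
  proof (rule besov_modular_ge_levels[OF phi \<Omega> v F])
    fix k x assume "x \<in> superlevel \<Omega> v (2 powi (k + 1))"
    then have x: "x \<in> superlevel \<Omega> v (2 powi k)"
      using superlevel_antimono[OF power_int_increasing[of k "k + 1" "2::real"], of \<Omega> v] by auto
    have "2 * ennreal (\<theta>\<^sup>2 / (8 * K) * \<phi> k / m k) = ennreal (2 * (\<theta>\<^sup>2 / (8 * K) * \<phi> k / m k))"
      by (subst ennreal_mult') simp_all
    also have "2 * (\<theta>\<^sup>2 / (8 * K) * \<phi> k / m k) = \<theta>\<^sup>2 / (4 * K) * \<phi> k / m k" by (simp add: mult_ac)
    finally show "2 * ennreal (\<theta>\<^sup>2 / (8 * K) * \<phi> k / m k)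
        \<le> (\<integral>\<^sup>+ y\<in>\<Omega> - superlevel \<Omega> v (2 powi k). besov_kernel \<alpha> phi (2 powi k) (x - y) \<partial>lebesgue)"
      using besov_kernel_integral_Diff_ge[OF phi \<alpha> K \<theta> dens \<Omega> fin _ half x _ refl, of "2 powi k"]
      by (simp add: \<phi>_def m_def superlevel_def)
  qed
  also note modular
  finally have "(\<Sum>k\<in>F. \<theta>\<^sup>2 / (8 * K) * \<phi> k / m k * m (k + 1)) \<le> 1" by simp
  also have "(\<Sum>k\<in>F. \<theta>\<^sup>2 / (8 * K) * \<phi> k / m k * m (k + 1)) = (\<Sum>k\<in>F. m (k + 1) / m k * \<phi> k) * (\<theta>\<^sup>2 / (8 * K))"
    unfolding sum_distrib_right by (intro sum.cong) (simp_all add: mult_ac)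
  finally have "(\<Sum>k\<in>F. m (k + 1) / m k * \<phi> k) \<le> 1 / (\<theta>\<^sup>2 / (8 * K))"
    using K1 \<theta> by (subst pos_le_divide_eq) auto
  then show ?thesis by (simp add: \<phi>_def)
qed

definition half_support_powr_bound :: "real \<Rightarrow> (real \<Rightarrow> real) \<Rightarrow> 'a::euclidean_space set \<Rightarrow> real \<Rightarrow> bool" where
  "half_support_powr_bound \<alpha> phi \<Omega> I \<longleftrightarrow> (\<forall>v\<in>borel_measurable (lebesgue_on \<Omega>).
     (\<forall>x\<in>\<Omega>. 0 \<le> v x) \<longrightarrow> superlevel \<Omega> v 0 \<in> lmeasurable \<longrightarrow>
     2 * emeasure lebesgue (superlevel \<Omega> v 0) \<le> emeasure lebesgue \<Omega> \<longrightarrow>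
     besov_modular \<alpha> phi \<Omega> v 1 \<le> 1 \<longrightarrow>
     (\<integral>\<^sup>+ x\<in>\<Omega>. ennreal (v x powr (real DIM('a) / \<bar>\<alpha>\<bar>)) \<partial>lebesgue) \<le> ennreal I)"

lemma half_support_powr_boundD:
  fixes v :: "'a::euclidean_space \<Rightarrow> real"
  assumes "half_support_powr_bound \<alpha> phi \<Omega> I" "v \<in> borel_measurable (lebesgue_on \<Omega>)"
    "\<And>x. x \<in> \<Omega> \<Longrightarrow> 0 \<le> v x" "superlevel \<Omega> v 0 \<in> lmeasurable"
    "2 * emeasure lebesgue (superlevel \<Omega> v 0) \<le> emeasure lebesgue \<Omega>" "besov_modular \<alpha> phi \<Omega> v 1 \<le> 1"
  shows "(\<integral>\<^sup>+ x\<in>\<Omega>. ennreal (v x powr (real DIM('a) / \<bar>\<alpha>\<bar>)) \<partial>lebesgue) \<le> ennreal I"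
  using assms by (simp add: half_support_powr_bound_def)

lemma powr_integral_le_if_dyadic_sums_le:
  fixes \<Omega> :: "'a::euclidean_space set"
  assumes \<Omega>: "\<Omega> \<in> sets lebesgue" and v: "v \<in> borel_measurable (lebesgue_on \<Omega>)" "\<And>x. x \<in> \<Omega> \<Longrightarrow> 0 \<le> v x"
    and fin: "\<And>k::int. superlevel \<Omega> v (2 powi k) \<in> lmeasurable" and q: "0 < q" and C: "0 \<le> C"
    and sum_le: "\<And>F. finite F \<Longrightarrow>
      (\<Sum>k\<in>F. (2 powi k * measure lebesgue (superlevel \<Omega> v (2 powi k)) powr (1 / q)) powr q) \<le> C"
  shows "(\<integral>\<^sup>+ x\<in>\<Omega>. ennreal (v x powr q) \<partial>lebesgue) \<le> ennreal (2 powr q * C)"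
proof -
  define b where "b k = 2 powi k * measure lebesgue (superlevel \<Omega> v (2 powi k)) powr (1 / q)" for k :: int
  have "(\<integral>\<^sup>+ x\<in>\<Omega>. ennreal (v x powr q) \<partial>lebesgue) = (\<integral>\<^sup>+ x. ennreal (v x powr q) \<partial>lebesgue_on \<Omega>)"
    using \<Omega> by (simp add: nn_integral_restrict_space)
  also have "\<dots> \<le> ennreal (2 powr q) * (\<integral>\<^sup>+ k. ennreal ((2 powi k) powr q) *
      emeasure (lebesgue_on \<Omega>) {x\<in>space (lebesgue_on \<Omega>). 2 powi k < v x} \<partial>count_space UNIV)"
    using v q by (intro nn_integral_powr_le_dyadic_levels) auto
  also have "\<dots> = ennreal (2 powr q) * (\<integral>\<^sup>+ k. ennreal (b k powr q) \<partial>count_space UNIV)"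
  proof (intro arg_cong2[where f="(*)"] refl nn_integral_cong)
    fix k :: int
    have "emeasure (lebesgue_on \<Omega>) {x\<in>space (lebesgue_on \<Omega>). 2 powi k < v x}
        = emeasure lebesgue (superlevel \<Omega> v (2 powi k))"
      using \<Omega> by (subst emeasure_restrict_space) (auto simp: superlevel_def)
    also have "\<dots> = ennreal (measure lebesgue (superlevel \<Omega> v (2 powi k)))"
      by (rule emeasure_eq_measure2[OF fin])
    finally show "ennreal ((2 powi k) powr q)
        * emeasure (lebesgue_on \<Omega>) {x\<in>space (lebesgue_on \<Omega>). 2 powi k < v x}
        = ennreal (b k powr q)"
      using q by (simp add: b_def ennreal_mult[symmetric] powr_mult powr_powr)
  qed
  also have "\<dots> \<le> ennreal (2 powr q) * ennreal C"
    using sum_le by (intro mult_left_mono nn_integral_count_space_le_if_finite_sums_le)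
      (auto simp: b_def intro: ennreal_leI)
  also have "\<dots> = ennreal (2 powr q * C)" using C by (simp add: ennreal_mult)
  finally show ?thesis .
qed

lemma measure_density_sum_young_levels_le:
  fixes \<Omega> :: "'a::euclidean_space set" and v :: "'a \<Rightarrow> real" and F :: "int set"
  assumes phi: "young_function phi" and \<alpha>: "\<alpha> < 0" and K: "upper_type phi (real DIM('a) / \<bar>\<alpha>\<bar>) K"
    and \<theta>: "0 < \<theta>" "\<theta> \<le> 1" and dens: "measure_density_condition \<theta> \<Omega>"
    and \<Omega>: "\<Omega> \<in> sets lebesgue" and v: "v \<in> borel_measurable (lebesgue_on \<Omega>)"
    and fin: "superlevel \<Omega> v 0 \<in> lmeasurable"
    and half: "2 * emeasure lebesgue (superlevel \<Omega> v 0) \<le> emeasure lebesgue \<Omega>"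
    and modular: "besov_modular \<alpha> phi \<Omega> v 1 \<le> 1" and F: "finite F"
    and q: "q = real DIM('a) / \<bar>\<alpha>\<bar>"
  shows "(\<Sum>k\<in>F. phi (2 powi k * measure lebesgue (superlevel \<Omega> v (2 powi k)) powr (1 / q)))
    \<le> 2 * (K * 4 powr q * (8 * K / \<theta>\<^sup>2))"
proof -
  have q0: "0 < q" "\<bar>\<alpha>\<bar> / real DIM('a) = 1 / q" using \<alpha> by (auto simp: q divide_less_0_iff)
  have level_fin: "superlevel \<Omega> v (2 powi k) \<in> lmeasurable" for k :: int
    by (rule lmeasurable_superlevel[OF \<Omega> v fin]) simp
  have "emeasure lebesgue (superlevel \<Omega> v (2 powi k)) \<le> emeasure lebesgue (superlevel \<Omega> v 0)" for k :: int
    using fin by (intro emeasure_mono superlevel_antimono) auto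
  then have level_half: "2 * emeasure lebesgue (superlevel \<Omega> v (2 powi k)) \<le> emeasure lebesgue \<Omega>" for k :: int
    using half by (meson mult_left_mono order_trans zero_le)
  define m where "m k = measure lebesgue (superlevel \<Omega> v (2 powi k))" for k :: int
  have m: "0 \<le> m k" "m (k + 1) \<le> m k" "m k \<le> measure lebesgue (superlevel \<Omega> v 0)" for k
    using fin level_fin
    by (simp_all add: m_def measure_mono_fmeasurable superlevel_antimono power_int_increasing fmeasurableD)
  have "(\<Sum>k\<in>F. m (k + 1) / m k * phi (2 powi k * m k powr (1 / q))) \<le> 8 * K / \<theta>\<^sup>2"
    if "finite F" for F
    using measure_density_level_ratio_sum_le[OF phi \<alpha> K \<theta> dens \<Omega> v level_fin level_half modular that]
    by (simp add: m_def q0(2))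
  then show ?thesis
    unfolding m_def[symmetric] by (rule sum_young_dyadic_le[where m=m, OF phi q0(1) K[folded q] m _ F])
qed

lemma measure_density_imp_half_support_powr_bound:
  fixes \<Omega> :: "'a::euclidean_space set"
  assumes phi: "young_function phi" and \<alpha>: "\<alpha> < 0" and up: "upper_Lambda DIM('a) phi \<alpha> < \<infinity>"
    and \<theta>: "0 < \<theta>" "\<theta> \<le> 1" and dens: "measure_density_condition \<theta> \<Omega>" and \<Omega>: "\<Omega> \<in> sets lebesgue"
  shows "\<exists>I\<ge>0. half_support_powr_bound \<alpha> phi \<Omega> I"
proof -
  define q where "q = real DIM('a) / \<bar>\<alpha>\<bar>"
  have q: "0 < q" using \<alpha> by (auto simp: q_def divide_less_0_iff)
  obtain K where K: "upper_type phi q K"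
    using upper_type_if_upper_Lambda_finite[OF phi \<alpha> up] unfolding q_def by blast
  define c where "c = 2 * (K * 4 powr q * (8 * K / \<theta>\<^sup>2))"
  have c: "0 \<le> c" using upper_typeD(1)[OF K] by (simp add: c_def)
  obtain C where C: "0 \<le> C"
    and sum_powr: "\<And>(F :: int set) b. \<lbrakk>finite F; \<And>i. i \<in> F \<Longrightarrow> 0 \<le> b i; (\<Sum>i\<in>F. phi (b i)) \<le> c\<rbrakk>
      \<Longrightarrow> (\<Sum>i\<in>F. b i powr q) \<le> C"
    using sum_powr_le_if_sum_young_le[OF phi K c] by blast
  have "(\<integral>\<^sup>+ x\<in>\<Omega>. ennreal (v x powr q) \<partial>lebesgue) \<le> ennreal (2 powr q * C)"
    if v: "v \<in> borel_measurable (lebesgue_on \<Omega>)" "\<And>x. x \<in> \<Omega> \<Longrightarrow> 0 \<le> v x"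
      and fin: "superlevel \<Omega> v 0 \<in> lmeasurable"
      and half: "2 * emeasure lebesgue (superlevel \<Omega> v 0) \<le> emeasure lebesgue \<Omega>"
      and modular: "besov_modular \<alpha> phi \<Omega> v 1 \<le> 1" for v
  proof (rule powr_integral_le_if_dyadic_sums_le[OF \<Omega> v _ q C])
    show "superlevel \<Omega> v (2 powi k) \<in> lmeasurable" for k :: int
      by (rule lmeasurable_superlevel[OF \<Omega> v(1) fin]) simp
    show "(\<Sum>k\<in>F. (2 powi k * measure lebesgue (superlevel \<Omega> v (2 powi k)) powr (1 / q)) powr q) \<le> C"
      if "finite F" for F :: "int set"
      using measure_density_sum_young_levels_le[OF phi \<alpha> K[unfolded q_def] \<theta> dens \<Omega> v(1) fin half
          modular that q_def]
      by (intro sum_powr that) (simp_all add: c_def q_def)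
  qed
  then have "half_support_powr_bound \<alpha> phi \<Omega> (2 powr q * C)"
    by (simp add: half_support_powr_bound_def q_def)
  then show ?thesis using C by (intro exI[of _ "2 powr q * C"]) simp
qed

section \<open>Medians and averages\<close>

lemma (in finite_borel_measure) exists_median:
  "\<exists>c. 2 * measure M {c<..} \<le> measure M UNIV \<and> 2 * measure M {..<c} \<le> measure M UNIV"
proof (cases "measure M UNIV = 0")
  case True
  then have "measure M B = 0" for B
    using bounded_measure[of B] measure_nonneg[of M B] by (simp add: borel_UNIV)
  then show ?thesis by simp
next
  case False
  define V where "V = measure M UNIV"
  have V: "0 < V" using False by (simp add: V_def zero_less_measure_iff)
  define S where "S = {t. V \<le> 2 * cdf M t}"
  have "eventually (\<lambda>t. V / 2 < cdf M t) at_top"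
    using cdf_lim_at_top V
    by (intro order_tendstoD(1)[where y="measure M (space M)"]) (auto simp: borel_UNIV V_def)
  then have S_ne: "S \<noteq> {}" by (auto simp: S_def eventually_at_top_linorder field_simps intro: less_imp_le)
  have "eventually (\<lambda>t. cdf M t < V / 2) at_bot"
    using cdf_lim_at_bot V by (intro order_tendstoD(2)[where y=0]) auto
  then obtain b where b: "\<And>t. t \<le> b \<Longrightarrow> cdf M t < V / 2" by (auto simp: eventually_at_bot_linorder)
  have "b \<le> t" if "t \<in> S" for t using that b[of t] by (cases "t \<le> b") (auto simp: S_def)
  then have S_bdd: "bdd_below S" by (rule bdd_belowI)
  define c where "c = Inf S"
  have above: "V / 2 \<le> cdf M t" if t: "c < t" for t
  proof -
    obtain s where "s \<in> S" "s < t" using cInf_lessD[OF S_ne t[unfolded c_def]] by blast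
    then show ?thesis using cdf_nondecreasing[of s t] by (simp add: S_def)
  qed
  have below: "cdf M t \<le> V / 2" if "t < c" for t
    using that cInf_lower[OF _ S_bdd, of t] by (force simp: S_def c_def)
  have "V / 2 \<le> cdf M c"
    using cdf_is_right_cont[of c] above unfolding continuous_within
    by (intro tendsto_lowerbound[where F="at_right c"]) (auto simp: eventually_at_filter)
  moreover have "measure M {c<..} = V - cdf M c"
    using finite_measure_compl[of "{..c}"]
    by (simp add: cdf_def V_def borel_UNIV Compl_eq_Diff_UNIV[symmetric] Compl_atMost sets_M)
  moreover have "measure M {..<c} \<le> V / 2"
    using cdf_at_left[of c] below
    by (intro tendsto_upperbound[where F="at_left c"]) (auto simp: eventually_at_filter)
  ultimately show ?thesis by (intro exI[of _ c]) (simp add: V_def)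
qed

lemma (in finite_measure) exists_median_of:
  assumes f: "f \<in> borel_measurable M"
  obtains c :: real where "2 * measure M {x\<in>space M. c < f x} \<le> measure M (space M)"
    "2 * measure M {x\<in>space M. f x < c} \<le> measure M (space M)"
proof -
  define N where "N = distr M borel f"
  interpret N: finite_borel_measure N
    unfolding finite_borel_measure_def finite_borel_measure_axioms_def N_def
    by (simp add: finite_measure_distr[OF f])
  have measure_N: "measure N B = measure M {x\<in>space M. f x \<in> B}" if "B \<in> sets borel" for B
    unfolding N_def measure_distr[OF f that] by (rule arg_cong[where f="measure M"]) auto
  obtain c where "2 * measure N {c<..} \<le> measure N UNIV" "2 * measure N {..<c} \<le> measure N UNIV"
    using N.exists_median by blast
  then show thesis by (intro that[of c]) (simp_all add: measure_N)
qed

lemma (in finite_measure) integrable_if_powr_integrable: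
  fixes f :: "'a \<Rightarrow> real"
  assumes [measurable]: "f \<in> borel_measurable M" and p: "1 \<le> p"
    and powr_int: "integrable M (\<lambda>x. \<bar>f x\<bar> powr p)"
  shows "integrable M f"
proof (rule Bochner_Integration.integrable_bound)
  show "integrable M (\<lambda>x. 1 + \<bar>f x\<bar> powr p)" using powr_int by simp
  have "\<bar>t\<bar> \<le> 1 + \<bar>t\<bar> powr p" for t :: real
  proof (cases "\<bar>t\<bar> \<le> 1")
    case False
    then have "\<bar>t\<bar> powr 1 \<le> \<bar>t\<bar> powr p" using p by (intro powr_mono) auto
    then show ?thesis using False by simp
  qed (simp add: add_increasing2)
  then show "AE x in M. norm (f x) \<le> norm (1 + \<bar>f x\<bar> powr p)" by simp
qed measurable

text \<open>With \<open>t\<close> the absolute value of the average, the inequality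
  \<open>y \<le> t / 2 + (2 / t)\<^bsup>p - 1\<^esup> y\<^sup>p\<close> is integrated over \<open>y = \<bar>f x\<bar>\<close>.\<close>

lemma (in finite_measure) measure_times_powr_average_le:
  fixes f :: "'a \<Rightarrow> real"
  assumes f: "f \<in> borel_measurable M" and p: "1 \<le> p" and powr_int: "integrable M (\<lambda>x. \<bar>f x\<bar> powr p)"
  shows "measure M (space M) * \<bar>integral\<^sup>L M f / measure M (space M)\<bar> powr p
    \<le> 2 powr p * (\<integral>x. \<bar>f x\<bar> powr p \<partial>M)"
proof -
  define V where "V = measure M (space M)"
  define t where "t = \<bar>integral\<^sup>L M f / V\<bar>"
  show ?thesis
  proof (cases "t = 0")
    case True
    then show ?thesis unfolding V_def[symmetric] t_def[symmetric] by (simp add: integral_nonneg)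
  next
    case False
    then have t: "0 < t" and V: "0 < V" by (auto simp: t_def V_def zero_less_measure_iff)
    have splitting: "y \<le> t / 2 + (2 / t) powr (p - 1) * y powr p" if y: "0 \<le> y" for y
    proof (cases "y \<le> t / 2")
      case False
      then have "1 \<le> (2 / t * y) powr (p - 1)"
        using t p by (intro ge_one_powr_ge_zero) (auto simp: field_simps)
      then have "y * 1 \<le> y * (2 / t * y) powr (p - 1)" using y by (rule mult_left_mono)
      also have "\<dots> = (2 / t) powr (p - 1) * y powr p"
        unfolding powr_mult using y by (cases "y = 0") (simp_all add: powr_diff)
      finally show ?thesis using t by simp
    qed (simp add: add_increasing2)
    have "V * t = \<bar>integral\<^sup>L M f\<bar>" using V by (simp add: t_def)
    also have "\<dots> \<le> (\<integral>x. \<bar>f x\<bar> \<partial>M)" by (rule integral_abs_bound)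
    also have "\<dots> \<le> (\<integral>x. t / 2 + (2 / t) powr (p - 1) * \<bar>f x\<bar> powr p \<partial>M)"
      using integrable_if_powr_integrable[OF f p powr_int] powr_int splitting by (intro integral_mono) auto
    also have "\<dots> = V * t / 2 + (2 / t) powr (p - 1) * (\<integral>x. \<bar>f x\<bar> powr p \<partial>M)"
      using powr_int by (simp add: V_def)
    finally have "V * t * t powr (p - 1) \<le> 2 * (2 / t) powr (p - 1) * (\<integral>x. \<bar>f x\<bar> powr p \<partial>M) * t powr (p - 1)"
      by (intro mult_right_mono) auto
    also have "\<dots> = 2 powr p * (\<integral>x. \<bar>f x\<bar> powr p \<partial>M)"
      using t by (simp add: powr_divide powr_diff)
    also have "V * t * t powr (p - 1) = V * t powr p" using t by (simp add: powr_diff)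
    finally show ?thesis by (simp add: V_def t_def)
  qed
qed

lemma (in finite_measure) nn_integral_powr_diff_average_le:
  fixes f :: "'a \<Rightarrow> real"
  assumes f [measurable]: "f \<in> borel_measurable M" and p: "1 \<le> p" and V: "0 < measure M (space M)"
    and I: "0 \<le> I" "(\<integral>\<^sup>+ x. ennreal (\<bar>f x - c\<bar> powr p) \<partial>M) \<le> ennreal I"
  shows "(\<integral>\<^sup>+ x. ennreal (\<bar>f x - integral\<^sup>L M f / measure M (space M)\<bar> powr p) \<partial>M)
    \<le> ennreal (2 powr p * (I + 2 powr p * I))"
proof -
  define V where "V = measure M (space M)"
  define g where "g x = f x - c" for x
  have g [measurable]: "g \<in> borel_measurable M" unfolding g_def by measurable
  have powr_int: "integrable M (\<lambda>x. \<bar>g x\<bar> powr p)"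
    using I le_less_trans[OF I(2) ennreal_less_top] by (intro integrableI_nonneg) (auto simp: g_def)
  have powr_int_I: "(\<integral>x. \<bar>g x\<bar> powr p \<partial>M) \<le> I"
    using I nn_integral_eq_integral[OF powr_int] by (simp add: g_def)
  define t where "t = \<bar>integral\<^sup>L M g / V\<bar>"
  have "V * t powr p \<le> 2 powr p * (\<integral>x. \<bar>g x\<bar> powr p \<partial>M)"
    unfolding t_def V_def by (rule measure_times_powr_average_le[OF g p powr_int])
  also have "\<dots> \<le> 2 powr p * I" using powr_int_I by (rule mult_left_mono) simp
  finally have Vt: "V * t powr p \<le> 2 powr p * I" .
  have "integral\<^sup>L M f = (\<integral>x. g x + c \<partial>M)" by (simp add: g_def)
  also have "\<dots> = integral\<^sup>L M g + V * c"
    using integrable_if_powr_integrable[OF g p powr_int] by (simp add: V_def)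
  finally have average: "integral\<^sup>L M f / V = integral\<^sup>L M g / V + c"
    using V by (simp add: V_def add_divide_distrib)
  have pointwise: "\<bar>f x - integral\<^sup>L M f / V\<bar> powr p \<le> 2 powr p * (\<bar>g x\<bar> powr p + t powr p)" for x
  proof -
    have "\<bar>f x - integral\<^sup>L M f / V\<bar> = \<bar>g x - integral\<^sup>L M g / V\<bar>" by (simp add: average g_def)
    also have "\<dots> \<le> 2 * max \<bar>g x\<bar> t" unfolding t_def by linarith
    finally have "\<bar>f x - integral\<^sup>L M f / V\<bar> powr p \<le> (2 * max \<bar>g x\<bar> t) powr p"
      using p by (intro powr_mono2) auto
    also have "\<dots> \<le> 2 powr p * (\<bar>g x\<bar> powr p + t powr p)"
      unfolding powr_mult by (intro mult_left_mono) (auto simp: max_def)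
    finally show ?thesis .
  qed
  have "(\<integral>\<^sup>+ x. ennreal (\<bar>f x - integral\<^sup>L M f / V\<bar> powr p) \<partial>M)
      \<le> (\<integral>\<^sup>+ x. ennreal (2 powr p * (\<bar>g x\<bar> powr p + t powr p)) \<partial>M)"
    by (intro nn_integral_mono ennreal_leI pointwise)
  also have "\<dots> = ennreal (2 powr p * ((\<integral>x. \<bar>g x\<bar> powr p \<partial>M) + V * t powr p))"
    using powr_int by (subst nn_integral_eq_integral) (auto simp: V_def)
  also have "\<dots> \<le> ennreal (2 powr p * (I + 2 powr p * I))"
    using powr_int_I Vt by (intro ennreal_leI mult_left_mono add_mono) auto
  finally show ?thesis unfolding V_def .
qed

section \<open>Lebesgue and Besov norms\<close>

lemma powr_le_powr_iff:
  fixes a b p :: real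
  assumes "0 < p" "0 \<le> a" "0 \<le> b"
  shows "a powr p \<le> b powr p \<longleftrightarrow> a \<le> b"
  using assms powr_mono2[of p a b] powr_less_mono2[of p b a] by (auto simp: not_le[symmetric])

lemma Lp_norm_le_iff:
  assumes p: "0 < p" and M: "0 \<le> M"
  shows "Lp_norm p \<Omega> f \<le> ennreal M \<longleftrightarrow> (\<integral>\<^sup>+ x\<in>\<Omega>. ennreal (\<bar>f x\<bar> powr p) \<partial>lebesgue) \<le> ennreal (M powr p)"
proof (cases "\<integral>\<^sup>+ x\<in>\<Omega>. ennreal (\<bar>f x\<bar> powr p) \<partial>lebesgue")
  case (real I)
  then have "Lp_norm p \<Omega> f = ennreal (I powr (1 / p))" by (simp add: Lp_norm_def)
  moreover have "I powr (1 / p) \<le> M \<longleftrightarrow> I \<le> M powr p"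
    using powr_le_powr_iff[of p "I powr (1 / p)" M] p M real by (simp add: powr_powr)
  ultimately show ?thesis using real M by simp
next
  case top
  then show ?thesis by (simp add: Lp_norm_def top_unique)
qed

lemma Lp_norm_le_besov_normI:
  assumes \<Omega>: "\<Omega> \<in> sets lebesgue" and u: "u \<in> besov_space \<alpha> phi \<Omega>"
    and f: "f \<in> borel_measurable (lebesgue_on \<Omega>)" and p: "0 < p" and I: "0 \<le> I"
    and ball_bound: "\<And>lam. 0 < lam \<Longrightarrow> besov_modular \<alpha> phi \<Omega> u lam \<le> 1 \<Longrightarrow>
      (\<integral>\<^sup>+ x\<in>\<Omega>. ennreal (\<bar>f x / lam\<bar> powr p) \<partial>lebesgue) \<le> ennreal I"
  shows "Lp_norm p \<Omega> f \<le> ennreal (max 1 (I powr (1 / p)) * besov_norm \<alpha> phi \<Omega> u)"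
proof -
  define C where "C = max 1 (I powr (1 / p))"
  have C: "1 \<le> C" by (simp add: C_def)
  have "I = (I powr (1 / p)) powr p" using I p by (simp add: powr_powr)
  also have "\<dots> \<le> C powr p" using p by (intro powr_mono2) (auto simp: C_def)
  finally have I_le: "I \<le> C powr p" .
  have admissible_bound: "Lp_norm p \<Omega> f \<le> ennreal (C * lam)"
    if lam: "lam \<in> besov_admissible \<alpha> phi \<Omega> u" for lam
  proof -
    from lam have lam: "0 < lam" "besov_modular \<alpha> phi \<Omega> u lam \<le> 1" by (auto simp: besov_admissible_def)
    have "(\<integral>\<^sup>+ x\<in>\<Omega>. ennreal (\<bar>f x\<bar> powr p) \<partial>lebesgue)
        = (\<integral>\<^sup>+ x. ennreal (lam powr p) * ennreal (\<bar>f x / lam\<bar> powr p) \<partial>lebesgue_on \<Omega>)"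
      using \<Omega> lam(1) by (simp add: nn_integral_restrict_space powr_divide ennreal_mult[symmetric] abs_divide)
    also have "\<dots> = ennreal (lam powr p) * (\<integral>\<^sup>+ x\<in>\<Omega>. ennreal (\<bar>f x / lam\<bar> powr p) \<partial>lebesgue)"
      using \<Omega> f by (subst nn_integral_cmult) (auto simp: nn_integral_restrict_space)
    also have "\<dots> \<le> ennreal (lam powr p) * ennreal (C powr p)"
      using ball_bound[OF lam] I_le by (meson ennreal_leI mult_left_mono order_trans zero_le)
    also have "\<dots> = ennreal ((C * lam) powr p)" by (simp add: ennreal_mult[symmetric] powr_mult mult.commute)
    finally show ?thesis using C lam(1) p by (subst Lp_norm_le_iff) auto
  qed
  have admissible_ne: "besov_admissible \<alpha> phi \<Omega> u \<noteq> {}" using u by (simp add: besov_space_def)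
  then obtain lam0 where lam0: "lam0 \<in> besov_admissible \<alpha> phi \<Omega> u" by blast
  obtain x where x: "Lp_norm p \<Omega> f = ennreal x" "0 \<le> x"
    using admissible_bound[OF lam0] by (cases "Lp_norm p \<Omega> f") (auto simp: top_unique)
  have "x / C \<le> besov_norm \<alpha> phi \<Omega> u"
    unfolding besov_norm_def
  proof (rule cInf_greatest[OF admissible_ne])
    fix lam assume lam: "lam \<in> besov_admissible \<alpha> phi \<Omega> u"
    then have "0 < lam" by (simp add: besov_admissible_def)
    then show "x / C \<le> lam" using admissible_bound[OF lam] C x by (simp add: divide_le_eq mult.commute)
  qed
  then show ?thesis using C x by (simp add: divide_le_eq mult.commute C_def ennreal_leI)
qed

section \<open>From regularity to the embedding\<close>

definition besov_embedding :: "real \<Rightarrow> (real \<Rightarrow> real) \<Rightarrow> 'a::euclidean_space set \<Rightarrow> real \<Rightarrow> bool" where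
  "besov_embedding \<alpha> phi \<Omega> C \<longleftrightarrow>
    (bounded \<Omega> \<longrightarrow> (\<forall>u\<in>besov_space \<alpha> phi \<Omega>.
       Lp_norm (real DIM('a) / \<bar>\<alpha>\<bar>) \<Omega> (\<lambda>x. u x - average \<Omega> u) \<le> ennreal (C * besov_norm \<alpha> phi \<Omega> u))) \<and>
    (\<not> bounded \<Omega> \<longrightarrow> (\<forall>u\<in>besov_space \<alpha> phi \<Omega>. bounded {x\<in>\<Omega>. u x \<noteq> 0} \<longrightarrow>
       Lp_norm (real DIM('a) / \<bar>\<alpha>\<bar>) \<Omega> u \<le> ennreal (C * besov_norm \<alpha> phi \<Omega> u)))"

lemma emeasure_ball_Int:
  fixes \<Omega> :: "'a::euclidean_space set"
  assumes "\<Omega> \<in> sets lebesgue"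
  shows "emeasure lebesgue (ball x r \<inter> \<Omega>) = ennreal (measure lebesgue (ball x r \<inter> \<Omega>))"
  using assms by (intro emeasure_eq_measure2 bounded_set_imp_lmeasurable sets.Int) auto

lemma globally_regular_imp_measure_density:
  fixes \<Omega> :: "'a::euclidean_space set"
  assumes reg: "globally_regular \<Omega>" and \<Omega>: "\<Omega> \<in> sets lebesgue"
  obtains \<theta> where "0 < \<theta>" "\<theta> \<le> 1" "measure_density_condition \<theta> \<Omega>"
proof -
  obtain \<theta> where \<theta>: "0 < \<theta>" "\<theta> < 1" and dens: "\<And>x r. x \<in> \<Omega> \<Longrightarrow> 0 < r \<Longrightarrow>
      (bounded \<Omega> \<longrightarrow> r < 2 * diameter \<Omega>) \<Longrightarrow> \<theta> * r ^ DIM('a) \<le> measure lebesgue (ball x r \<inter> \<Omega>)"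
    using reg unfolding globally_regular_def by blast
  have "min (ennreal (\<theta> * r ^ DIM('a))) (emeasure lebesgue \<Omega>) \<le> emeasure lebesgue (ball x r \<inter> \<Omega>)"
    if x: "x \<in> \<Omega>" and r: "0 < r" for x r
  proof (cases "bounded \<Omega> \<longrightarrow> r < 2 * diameter \<Omega>")
    case True
    then show ?thesis using dens[OF x r] by (simp add: emeasure_ball_Int[OF \<Omega>] ennreal_leI min.coboundedI1)
  next
    case False
    then have b: "bounded \<Omega>" and large: "2 * diameter \<Omega> \<le> r" by auto
    have "dist x y < r" if "y \<in> \<Omega>" for y
      using diameter_bounded_bound[OF b x that] diameter_ge_0[OF b] large r by linarith
    then have "ball x r \<inter> \<Omega> = \<Omega>" by auto
    then show ?thesis by simp
  qed
  with \<theta> show thesis by (intro that[of \<theta>]) (auto simp: measure_density_condition_def)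
qed

lemma emeasure_infinite_if_globally_regular:
  fixes \<Omega> :: "'a::euclidean_space set"
  assumes reg: "globally_regular \<Omega>" and unbounded: "\<not> bounded \<Omega>" and \<Omega>: "\<Omega> \<in> sets lebesgue"
  shows "emeasure lebesgue \<Omega> = \<infinity>"
proof (rule ccontr)
  assume "emeasure lebesgue \<Omega> \<noteq> \<infinity>"
  then obtain M where M: "emeasure lebesgue \<Omega> = ennreal M" "0 \<le> M" by (cases "emeasure lebesgue \<Omega>") auto
  obtain \<theta> where \<theta>: "0 < \<theta>" and dens: "\<And>x r. x \<in> \<Omega> \<Longrightarrow> 0 < r \<Longrightarrow>
      \<theta> * r ^ DIM('a) \<le> measure lebesgue (ball x r \<inter> \<Omega>)"
    using reg unbounded unfolding globally_regular_def by blast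
  obtain x where x: "x \<in> \<Omega>" using unbounded by fastforce
  define r where "r = M / \<theta> + 1"
  have r: "1 \<le> r" using M \<theta> by (simp add: r_def)
  have "\<theta> * r \<le> \<theta> * r ^ DIM('a)" using \<theta> r by (intro mult_left_mono self_le_power) auto
  also have "\<dots> \<le> measure lebesgue (ball x r \<inter> \<Omega>)" using dens[OF x] r by simp
  also have "ennreal (measure lebesgue (ball x r \<inter> \<Omega>)) \<le> ennreal M"
    unfolding emeasure_ball_Int[OF \<Omega>, symmetric] M(1)[symmetric] using \<Omega> by (intro emeasure_mono) auto
  then have "measure lebesgue (ball x r \<inter> \<Omega>) \<le> M" using M by simp
  finally show False using \<theta> by (simp add: r_def distrib_left)
qed

lemma regular_unbounded_powr_integral_le:
  fixes \<Omega> :: "'a::euclidean_space set"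
  assumes phi: "young_function phi" and \<alpha>: "\<alpha> < 0" and up: "upper_Lambda DIM('a) phi \<alpha> < \<infinity>"
    and reg: "globally_regular \<Omega>" and unbounded: "\<not> bounded \<Omega>" and \<Omega>: "\<Omega> \<in> sets lebesgue"
  obtains I where "0 \<le> I"
    "\<And>u. \<lbrakk>u \<in> borel_measurable (lebesgue_on \<Omega>); bounded {x\<in>\<Omega>. u x \<noteq> 0}; besov_modular \<alpha> phi \<Omega> u 1 \<le> 1\<rbrakk>
     \<Longrightarrow> (\<integral>\<^sup>+ x\<in>\<Omega>. ennreal (\<bar>u x\<bar> powr (real DIM('a) / \<bar>\<alpha>\<bar>)) \<partial>lebesgue) \<le> ennreal I"
proof -
  obtain \<theta> where \<theta>: "0 < \<theta>" "\<theta> \<le> 1" "measure_density_condition \<theta> \<Omega>"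
    using globally_regular_imp_measure_density[OF reg \<Omega>] .
  obtain I where I: "0 \<le> I" "half_support_powr_bound \<alpha> phi \<Omega> I"
    using measure_density_imp_half_support_powr_bound[OF phi \<alpha> up \<theta> \<Omega>] by blast
  show thesis
  proof (rule that[OF I(1)])
    fix u assume u: "u \<in> borel_measurable (lebesgue_on \<Omega>)" "bounded {x\<in>\<Omega>. u x \<noteq> 0}"
      and modular: "besov_modular \<alpha> phi \<Omega> u 1 \<le> 1"
    have v: "(\<lambda>x. \<bar>u x\<bar>) \<in> borel_measurable (lebesgue_on \<Omega>)" using u(1) by measurable
    have "superlevel \<Omega> (\<lambda>x. \<bar>u x\<bar>) 0 = {x\<in>\<Omega>. u x \<noteq> 0}" by (auto simp: superlevel_def)
    then have fin: "superlevel \<Omega> (\<lambda>x. \<bar>u x\<bar>) 0 \<in> lmeasurable"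
      using sets_superlevel[OF \<Omega> v, of 0] u(2) by (intro bounded_set_imp_lmeasurable) simp_all
    have "besov_modular \<alpha> phi \<Omega> (\<lambda>x. \<bar>u x\<bar>) 1 \<le> besov_modular \<alpha> phi \<Omega> u 1"
      by (rule besov_modular_mono[OF phi]) (simp_all add: abs_triangle_ineq3)
    also note modular
    finally show "(\<integral>\<^sup>+ x\<in>\<Omega>. ennreal (\<bar>u x\<bar> powr (real DIM('a) / \<bar>\<alpha>\<bar>)) \<partial>lebesgue) \<le> ennreal I"
      using fin emeasure_infinite_if_globally_regular[OF reg unbounded \<Omega>]
      by (intro half_support_powr_boundD[OF I(2)] v) simp_all
  qed
qed

lemma half_support_powr_bound_positive_part:
  fixes u :: "'a::euclidean_space \<Rightarrow> real"
  assumes phi: "young_function phi" and bound: "half_support_powr_bound \<alpha> phi \<Omega> I" and \<Omega>: "\<Omega> \<in> lmeasurable"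
    and u [measurable]: "u \<in> borel_measurable (lebesgue_on \<Omega>)" and modular: "besov_modular \<alpha> phi \<Omega> u 1 \<le> 1"
    and half: "2 * measure lebesgue {x\<in>\<Omega>. c < u x} \<le> measure lebesgue \<Omega>"
  shows "(\<integral>\<^sup>+ x\<in>\<Omega>. ennreal (max 0 (u x - c) powr (real DIM('a) / \<bar>\<alpha>\<bar>)) \<partial>lebesgue) \<le> ennreal I"
proof -
  define v where "v x = max 0 (u x - c)" for x
  have v: "v \<in> borel_measurable (lebesgue_on \<Omega>)" unfolding v_def by measurable
  have level: "superlevel \<Omega> v 0 = {x\<in>\<Omega>. c < u x}" by (auto simp: superlevel_def v_def less_max_iff_disj)
  have fin: "superlevel \<Omega> v 0 \<in> lmeasurable"
    using sets_superlevel[OF fmeasurableD[OF \<Omega>] v]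
    by (rule fmeasurableI2[OF \<Omega>, rotated]) (auto simp: superlevel_def)
  have v_half: "2 * emeasure lebesgue (superlevel \<Omega> v 0) \<le> emeasure lebesgue \<Omega>"
    using ennreal_leI[OF half]
    by (simp add: level[symmetric] emeasure_eq_measure2[OF fin] emeasure_eq_measure2[OF \<Omega>] ennreal_mult)
  have "\<bar>v x - v y\<bar> \<le> \<bar>u x - u y\<bar>" for x y by (auto simp: v_def)
  then have "besov_modular \<alpha> phi \<Omega> v 1 \<le> besov_modular \<alpha> phi \<Omega> u 1"
    by (intro besov_modular_mono[OF phi]) simp_all
  also note modular
  finally show ?thesis
    using half_support_powr_boundD[OF bound v _ fin v_half] by (simp add: v_def)
qed

lemma half_support_powr_bound_median:
  fixes u :: "'a::euclidean_space \<Rightarrow> real"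
  assumes phi: "young_function phi" and \<alpha>: "\<alpha> \<noteq> 0" and bound: "half_support_powr_bound \<alpha> phi \<Omega> I"
    and I: "0 \<le> I"
    and \<Omega>: "\<Omega> \<in> lmeasurable" and u [measurable]: "u \<in> borel_measurable (lebesgue_on \<Omega>)"
    and modular: "besov_modular \<alpha> phi \<Omega> u 1 \<le> 1"
  obtains c where "(\<integral>\<^sup>+ x\<in>\<Omega>. ennreal (\<bar>u x - c\<bar> powr (real DIM('a) / \<bar>\<alpha>\<bar>)) \<partial>lebesgue) \<le> ennreal (2 * I)"
proof -
  define q where "q = real DIM('a) / \<bar>\<alpha>\<bar>"
  have q: "0 < q" using \<alpha> by (simp add: q_def)
  have \<Omega>_sets: "\<Omega> \<in> sets lebesgue" using \<Omega> by auto
  interpret finite_measure "lebesgue_on \<Omega>" by (rule finite_measure_lebesgue_on[OF \<Omega>])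
  have measure_on: "measure (lebesgue_on \<Omega>) B = measure lebesgue B" if "B \<subseteq> \<Omega>" for B
    using that \<Omega>_sets by (intro measure_restrict_space) auto
  obtain c where "2 * measure (lebesgue_on \<Omega>) {x\<in>\<Omega>. c < u x} \<le> measure (lebesgue_on \<Omega>) \<Omega>"
    "2 * measure (lebesgue_on \<Omega>) {x\<in>\<Omega>. u x < c} \<le> measure (lebesgue_on \<Omega>) \<Omega>"
    using exists_median_of[OF u] by auto
  then have c: "2 * measure lebesgue {x\<in>\<Omega>. c < u x} \<le> measure lebesgue \<Omega>"
    "2 * measure lebesgue {x\<in>\<Omega>. - c < - u x} \<le> measure lebesgue \<Omega>"
    by (simp_all add: measure_on)
  have "besov_modular \<alpha> phi \<Omega> (\<lambda>x. - u x) 1 \<le> besov_modular \<alpha> phi \<Omega> u 1"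
    by (rule besov_modular_mono[OF phi]) simp_all
  also note modular
  finally have neg_modular: "besov_modular \<alpha> phi \<Omega> (\<lambda>x. - u x) 1 \<le> 1" .
  have neg_u: "(\<lambda>x. - u x) \<in> borel_measurable (lebesgue_on \<Omega>)" by measurable
  have split: "ennreal (\<bar>u x - c\<bar> powr q)
      = ennreal (max 0 (u x - c) powr q) + ennreal (max 0 (- u x - - c) powr q)" for x
    using q by (simp add: max_def abs_if)
  have "(\<integral>\<^sup>+ x\<in>\<Omega>. ennreal (\<bar>u x - c\<bar> powr q) \<partial>lebesgue)
      = (\<integral>\<^sup>+ x. ennreal (max 0 (u x - c) powr q) + ennreal (max 0 (- u x - - c) powr q) \<partial>lebesgue_on \<Omega>)"
    unfolding split using \<Omega>_sets by (intro nn_integral_restrict_space[symmetric]) simp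
  also have "\<dots> = (\<integral>\<^sup>+ x. ennreal (max 0 (u x - c) powr q) \<partial>lebesgue_on \<Omega>)
      + (\<integral>\<^sup>+ x. ennreal (max 0 (- u x - - c) powr q) \<partial>lebesgue_on \<Omega>)"
    by (rule nn_integral_add) measurable
  also have "\<dots> \<le> ennreal I + ennreal I"
    using half_support_powr_bound_positive_part[OF phi bound \<Omega> u modular c(1)]
      half_support_powr_bound_positive_part[OF phi bound \<Omega> neg_u neg_modular c(2)] \<Omega>_sets
    by (intro add_mono) (simp_all add: nn_integral_restrict_space q_def)
  also have "\<dots> = ennreal (2 * I)" using I by (simp add: ennreal_plus[symmetric] del: ennreal_plus)
  finally show thesis unfolding q_def by (rule that)
qed

lemma regular_bounded_powr_integral_le:
  fixes \<Omega> :: "'a::euclidean_space set"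
  assumes phi: "young_function phi" and \<alpha>: "- real DIM('a) \<le> \<alpha>" "\<alpha> < 0"
    and up: "upper_Lambda DIM('a) phi \<alpha> < \<infinity>"
    and reg: "globally_regular \<Omega>" and \<Omega>: "\<Omega> \<in> lmeasurable" "0 < measure lebesgue \<Omega>"
  obtains I where "0 \<le> I"
    "\<And>u. \<lbrakk>u \<in> borel_measurable (lebesgue_on \<Omega>); besov_modular \<alpha> phi \<Omega> u 1 \<le> 1\<rbrakk>
     \<Longrightarrow> (\<integral>\<^sup>+ x\<in>\<Omega>. ennreal (\<bar>u x - average \<Omega> u\<bar> powr (real DIM('a) / \<bar>\<alpha>\<bar>)) \<partial>lebesgue) \<le> ennreal I"
proof -
  define q where "q = real DIM('a) / \<bar>\<alpha>\<bar>"
  have q: "1 \<le> q" unfolding q_def using \<alpha> by (subst le_divide_eq_1_pos) auto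
  have \<Omega>_sets: "\<Omega> \<in> sets lebesgue" using \<Omega>(1) by auto
  interpret finite_measure "lebesgue_on \<Omega>" by (rule finite_measure_lebesgue_on[OF \<Omega>(1)])
  have space_measure: "measure (lebesgue_on \<Omega>) (space (lebesgue_on \<Omega>)) = measure lebesgue \<Omega>"
    using \<Omega>_sets by (simp add: measure_restrict_space)
  obtain \<theta> where \<theta>: "0 < \<theta>" "\<theta> \<le> 1" "measure_density_condition \<theta> \<Omega>"
    using globally_regular_imp_measure_density[OF reg \<Omega>_sets] .
  obtain I where I: "0 \<le> I" "half_support_powr_bound \<alpha> phi \<Omega> I"
    using measure_density_imp_half_support_powr_bound[OF phi \<alpha>(2) up \<theta> \<Omega>_sets] by blast
  show thesis
  proof
    show "0 \<le> 2 powr q * (2 * I + 2 powr q * (2 * I))" using I(1) by simp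
    fix u assume u: "u \<in> borel_measurable (lebesgue_on \<Omega>)" and modular: "besov_modular \<alpha> phi \<Omega> u 1 \<le> 1"
    obtain c where "(\<integral>\<^sup>+ x\<in>\<Omega>. ennreal (\<bar>u x - c\<bar> powr q) \<partial>lebesgue) \<le> ennreal (2 * I)"
      using half_support_powr_bound_median[OF phi _ I(2,1) \<Omega>(1) u modular] \<alpha> unfolding q_def by blast
    then have "(\<integral>\<^sup>+ x. ennreal (\<bar>u x - integral\<^sup>L (lebesgue_on \<Omega>) u / measure lebesgue \<Omega>\<bar> powr q)
        \<partial>lebesgue_on \<Omega>)
        \<le> ennreal (2 powr q * (2 * I + 2 powr q * (2 * I)))"
      using nn_integral_powr_diff_average_le[OF u q, of "2 * I" c] I(1) \<Omega>(2) \<Omega>_sets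
      unfolding space_measure by (simp add: nn_integral_restrict_space)
    moreover have "average \<Omega> u = integral\<^sup>L (lebesgue_on \<Omega>) u / measure lebesgue \<Omega>"
      using \<Omega>_sets by (simp add: average_def set_lebesgue_integral_def integral_restrict_space)
    ultimately show "(\<integral>\<^sup>+ x\<in>\<Omega>. ennreal (\<bar>u x - average \<Omega> u\<bar> powr (real DIM('a) / \<bar>\<alpha>\<bar>)) \<partial>lebesgue)
        \<le> ennreal (2 powr q * (2 * I + 2 powr q * (2 * I)))"
      using \<Omega>_sets by (simp add: nn_integral_restrict_space q_def)
  qed
qed

lemma average_divide: "average \<Omega> (\<lambda>x. u x / c) = average \<Omega> u / c"
  by (simp add: average_def)

lemma regular_bounded_imp_besov_embedding:
  fixes \<Omega> :: "'a::euclidean_space set"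
  assumes phi: "young_function phi" and \<alpha>: "- real DIM('a) \<le> \<alpha>" "\<alpha> < 0"
    and up: "upper_Lambda DIM('a) phi \<alpha> < \<infinity>" and dom: "is_domain \<Omega>"
    and reg: "globally_regular \<Omega>" and bounded: "bounded \<Omega>"
  shows "\<exists>C\<ge>1. besov_embedding \<alpha> phi \<Omega> C"
proof -
  define q where "q = real DIM('a) / \<bar>\<alpha>\<bar>"
  have q: "0 < q" using \<alpha> by (auto simp: q_def divide_less_0_iff)
  have \<Omega>: "open \<Omega>" "\<Omega> \<noteq> {}" using dom by (auto simp: is_domain_def)
  have lmeas: "\<Omega> \<in> lmeasurable" using bounded \<Omega>(1) by (simp add: lmeasurable_open)
  have pos: "0 < measure lebesgue \<Omega>"
    using open_not_negligible[OF \<Omega>] lmeas by (simp add: negligible_iff_measure zero_less_measure_iff)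
  obtain I where I: "0 \<le> I" "\<And>u. \<lbrakk>u \<in> borel_measurable (lebesgue_on \<Omega>); besov_modular \<alpha> phi \<Omega> u 1 \<le> 1\<rbrakk>
     \<Longrightarrow> (\<integral>\<^sup>+ x\<in>\<Omega>. ennreal (\<bar>u x - average \<Omega> u\<bar> powr q) \<partial>lebesgue) \<le> ennreal I"
    using regular_bounded_powr_integral_le[OF phi \<alpha> up reg lmeas pos] unfolding q_def by blast
  have "Lp_norm q \<Omega> (\<lambda>x. u x - average \<Omega> u) \<le> ennreal (max 1 (I powr (1 / q)) * besov_norm \<alpha> phi \<Omega> u)"
    if u: "u \<in> besov_space \<alpha> phi \<Omega>" for u
  proof (rule Lp_norm_le_besov_normI[OF fmeasurableD[OF lmeas] u _ q I(1)])
    have u_meas: "u \<in> borel_measurable (lebesgue_on \<Omega>)" using u by (simp add: besov_space_def)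
    then show "(\<lambda>x. u x - average \<Omega> u) \<in> borel_measurable (lebesgue_on \<Omega>)" by simp
    fix lam :: real assume "0 < lam" "besov_modular \<alpha> phi \<Omega> u lam \<le> 1"
    then show "(\<integral>\<^sup>+ x\<in>\<Omega>. ennreal (\<bar>(u x - average \<Omega> u) / lam\<bar> powr q) \<partial>lebesgue) \<le> ennreal I"
      using u_meas I(2)[of "\<lambda>x. u x / lam"]
      by (simp add: besov_modular_divide average_divide diff_divide_distrib)
  qed
  then show ?thesis using bounded
    by (intro exI[of _ "max 1 (I powr (1 / q))"]) (simp add: besov_embedding_def q_def)
qed

lemma regular_unbounded_imp_besov_embedding:
  fixes \<Omega> :: "'a::euclidean_space set"
  assumes phi: "young_function phi" and \<alpha>: "\<alpha> < 0" and up: "upper_Lambda DIM('a) phi \<alpha> < \<infinity>"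
    and \<Omega>: "\<Omega> \<in> sets lebesgue" and reg: "globally_regular \<Omega>" and unbounded: "\<not> bounded \<Omega>"
  shows "\<exists>C\<ge>1. besov_embedding \<alpha> phi \<Omega> C"
proof -
  define q where "q = real DIM('a) / \<bar>\<alpha>\<bar>"
  have q: "0 < q" using \<alpha> by (auto simp: q_def divide_less_0_iff)
  obtain I where I: "0 \<le> I" "\<And>u. \<lbrakk>u \<in> borel_measurable (lebesgue_on \<Omega>); bounded {x\<in>\<Omega>. u x \<noteq> 0};
     besov_modular \<alpha> phi \<Omega> u 1 \<le> 1\<rbrakk> \<Longrightarrow> (\<integral>\<^sup>+ x\<in>\<Omega>. ennreal (\<bar>u x\<bar> powr q) \<partial>lebesgue) \<le> ennreal I"
    using regular_unbounded_powr_integral_le[OF phi \<alpha> up reg unbounded \<Omega>] unfolding q_def by blast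
  have "Lp_norm q \<Omega> u \<le> ennreal (max 1 (I powr (1 / q)) * besov_norm \<alpha> phi \<Omega> u)"
    if u: "u \<in> besov_space \<alpha> phi \<Omega>" "bounded {x\<in>\<Omega>. u x \<noteq> 0}" for u
  proof (rule Lp_norm_le_besov_normI[OF \<Omega> u(1) _ q I(1)])
    show u_meas: "u \<in> borel_measurable (lebesgue_on \<Omega>)" using u(1) by (simp add: besov_space_def)
    fix lam :: real assume "0 < lam" "besov_modular \<alpha> phi \<Omega> u lam \<le> 1"
    then show "(\<integral>\<^sup>+ x\<in>\<Omega>. ennreal (\<bar>u x / lam\<bar> powr q) \<partial>lebesgue) \<le> ennreal I"
      using u_meas u(2) by (intro I(2)) (simp_all add: besov_modular_divide)
  qed
  then show ?thesis using unbounded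
    by (intro exI[of _ "max 1 (I powr (1 / q))"]) (simp add: besov_embedding_def q_def)
qed

section \<open>Polar coordinates for radial functions\<close>

lemma set_nn_integral_power_Icc:
  fixes b c :: real
  assumes "0 \<le> c" "0 < n"
  shows "(\<integral>\<^sup>+ s\<in>{0..b}. ennreal (real n * c * s ^ (n - 1)) \<partial>lborel)
    = (if 0 \<le> b then ennreal (c * b ^ n) else 0)"
proof (cases "0 \<le> b")
  case True
  have "(\<integral>\<^sup>+ s\<in>{0..b}. ennreal (real n * c * s ^ (n - 1)) \<partial>lborel) = ennreal (c * b ^ n - c * 0 ^ n)"
  proof (rule nn_integral_FTC_Icc)
    fix s :: real assume "s \<in> {0..b}"
    then show "0 \<le> real n * c * s ^ (n - 1)" using assms by simp
    show "((\<lambda>s. c * s ^ n) has_real_derivative real n * c * s ^ (n - 1)) (at s)"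
      by (auto intro!: derivative_eq_intros)
  qed (use True in auto)
  then show ?thesis using True assms by (simp add: zero_power)
qed simp

lemma distr_norm_lborel:
  "distr (lborel :: 'a::euclidean_space measure) borel norm =
   density lborel (\<lambda>s::real. ennreal (real DIM('a) * unit_ball_vol DIM('a) * s ^ (DIM('a) - 1))
     * indicator {0..} s)"
  (is "?M = ?N")
proof (rule measure_eqI_generator_eq[where E="range atMost" and \<Omega>=UNIV and A="\<lambda>i::nat. {..real i}"])
  let ?n = "DIM('a)" and ?w = "unit_ball_vol (real DIM('a))"
  have M: "emeasure ?M {..b} = (if 0 \<le> b then ennreal (?w * b ^ ?n) else 0)" for b
  proof -
    have "emeasure ?M {..b} = emeasure lborel (cball (0::'a) b)"
      by (subst emeasure_distr) (auto intro!: arg_cong[where f="emeasure lborel"] simp: cball_def)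
    then show ?thesis by (simp add: emeasure_cball)
  qed
  show "emeasure ?M {..real i} \<noteq> \<infinity>" for i unfolding M by simp
  fix X :: "real set" assume "X \<in> range atMost"
  then obtain b where X: "X = {..b}" by auto
  have "emeasure ?N {..b} = (\<integral>\<^sup>+ s\<in>{0..b}. ennreal (real ?n * ?w * s ^ (?n - 1)) \<partial>lborel)"
    by (subst emeasure_density) (auto intro!: nn_integral_cong simp: indicator_def)
  also have "\<dots> = emeasure ?M {..b}" unfolding M by (rule set_nn_integral_power_Icc) simp_all
  finally show "emeasure ?M X = emeasure ?N X" unfolding X by simp
next
  show "Int_stable (range (atMost :: real \<Rightarrow> real set))" by (auto simp: Int_stable_def)
  have "sets borel = sigma_sets UNIV (range (atMost :: real \<Rightarrow> real set))"
    by (subst borel_eq_atMost) simp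
  then show "sets ?M = sigma_sets UNIV (range atMost)" "sets ?N = sigma_sets UNIV (range atMost)" by simp_all
  show "(\<Union>i::nat. {..real i}) = UNIV" using real_arch_simple by auto
qed auto

lemma nn_integral_norm_scaled:
  fixes g :: "real \<Rightarrow> ennreal"
  assumes g [measurable]: "g \<in> borel_measurable borel" and \<delta>: "0 < \<delta>"
  shows "(\<integral>\<^sup>+ y. g (norm (y::'a::euclidean_space)) \<partial>lborel) =
    (\<integral>\<^sup>+ t\<in>{0<..}. ennreal (real DIM('a) * unit_ball_vol DIM('a) * \<delta> ^ DIM('a) * t ^ (DIM('a) - 1))
      * g (\<delta> * t) \<partial>lborel)"
proof -
  let ?n = "DIM('a)" and ?w = "unit_ball_vol (real DIM('a))"
  define f where "f s = ennreal (real ?n * ?w * s ^ (?n - 1)) * indicator {0..} s * g s" for s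
  have f [measurable]: "f \<in> borel_measurable borel" unfolding f_def by measurable
  obtain m where m: "?n = Suc m" using DIM_positive gr0_conv_Suc by blast
  have scaled: "ennreal \<delta> * f (\<delta> * t)
      = ennreal (real ?n * ?w * \<delta> ^ ?n * t ^ (?n - 1)) * g (\<delta> * t) * indicator {0<..} t" if "t \<noteq> 0" for t
  proof (cases "0 < t")
    case True
    have "ennreal \<delta> * ennreal (real ?n * ?w * (\<delta> * t) ^ (?n - 1))
        = ennreal (real ?n * ?w * \<delta> ^ ?n * t ^ (?n - 1))"
      using \<delta> True by (simp add: ennreal_mult'[symmetric] m power_mult_distrib mult_ac)
    then show ?thesis using \<delta> True by (simp add: f_def mult.assoc[symmetric])
  next
    case False
    then show ?thesis using that \<delta> by (simp add: f_def indicator_def zero_le_mult_iff)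
  qed
  have "(\<integral>\<^sup>+ y. g (norm (y::'a)) \<partial>lborel) = (\<integral>\<^sup>+ s. g s \<partial>distr (lborel :: 'a measure) borel norm)"
    by (subst nn_integral_distr) auto
  also have "\<dots> = (\<integral>\<^sup>+ s. f s \<partial>lborel)"
    unfolding distr_norm_lborel f_def by (simp add: nn_integral_density)
  also have "\<dots> = ennreal \<delta> * (\<integral>\<^sup>+ t. f (\<delta> * t) \<partial>lborel)"
    using nn_integral_real_affine[OF f, of \<delta> 0] \<delta> by simp
  also have "\<dots> = (\<integral>\<^sup>+ t. ennreal \<delta> * f (\<delta> * t) \<partial>lborel)"
    by (rule nn_integral_cmult[symmetric]) measurable
  also have "\<dots> = (\<integral>\<^sup>+ t\<in>{0<..}. ennreal (real ?n * ?w * \<delta> ^ ?n * t ^ (?n - 1)) * g (\<delta> * t) \<partial>lborel)"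
    using AE_lborel_singleton[of "0::real"]
    by (intro nn_integral_cong_AE) (auto elim!: eventually_mono simp: scaled)
  finally show ?thesis .
qed

lemma nn_integral_even_kernel_pairs_meeting:
  fixes k :: "'a::euclidean_space \<Rightarrow> ennreal"
  assumes k [measurable]: "k \<in> borel_measurable borel" and even: "\<And>z. k (- z) = k z"
    and B [measurable]: "B \<in> sets borel"
  shows "(\<integral>\<^sup>+ x. \<integral>\<^sup>+ y. (indicator B x + indicator B y) * k (x - y) \<partial>lborel \<partial>lborel)
    = 2 * emeasure lborel B * (\<integral>\<^sup>+ z. k z \<partial>lborel)"
proof -
  define G where "G = (\<integral>\<^sup>+ z. k z \<partial>lborel)"
  have translate: "(\<integral>\<^sup>+ x. k (x - y) \<partial>lborel) = G" for y
  proof -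
    have "G = (\<integral>\<^sup>+ z. k z \<partial>distr lborel borel ((+) (- y)))" unfolding G_def lborel_distr_plus ..
    also have "\<dots> = (\<integral>\<^sup>+ x. k (- y + x) \<partial>lborel)" by (rule nn_integral_distr) auto
    finally show ?thesis by simp
  qed
  have reflect: "(\<integral>\<^sup>+ y. k (x - y) \<partial>lborel) = G" for x
    using translate[of x] even[of "y - x" for y] by simp
  have fst_in_B: "(\<integral>\<^sup>+ x. \<integral>\<^sup>+ y. indicator B x * k (x - y) \<partial>lborel \<partial>lborel) = emeasure lborel B * G"
    by (simp add: nn_integral_cmult reflect nn_integral_multc)
  have "(\<integral>\<^sup>+ x. \<integral>\<^sup>+ y. indicator B y * k (x - y) \<partial>lborel \<partial>lborel)
      = (\<integral>\<^sup>+ y. \<integral>\<^sup>+ x. indicator B y * k (x - y) \<partial>lborel \<partial>lborel)"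
    by (rule lborel_pair.Fubini'[symmetric]) measurable
  also have "\<dots> = emeasure lborel B * G"
    by (simp add: nn_integral_cmult translate nn_integral_multc)
  finally have snd_in_B: "(\<integral>\<^sup>+ x. \<integral>\<^sup>+ y. indicator B y * k (x - y) \<partial>lborel \<partial>lborel) = emeasure lborel B * G" .
  have "(\<integral>\<^sup>+ x. \<integral>\<^sup>+ y. (indicator B x + indicator B y) * k (x - y) \<partial>lborel \<partial>lborel)
      = (\<integral>\<^sup>+ x. \<integral>\<^sup>+ y. indicator B x * k (x - y) \<partial>lborel \<partial>lborel)
        + (\<integral>\<^sup>+ x. \<integral>\<^sup>+ y. indicator B y * k (x - y) \<partial>lborel \<partial>lborel)"
    by (simp add: distrib_right nn_integral_add)
  then show ?thesis unfolding fst_in_B snd_in_B G_def by (simp add: mult_2 distrib_right)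
qed

section \<open>Cutoff functions\<close>

lemma set_nn_integral_cutoff_profile_le:
  assumes phi: "young_function phi" and x: "0 < x"
  shows "(\<integral>\<^sup>+ t\<in>{0<..}. ennreal (phi (min 1 t * t powr (- \<alpha>) * x) / phi x / t ^ (n + 1)) \<partial>lborel)
    \<le> lower_Lambda n phi \<alpha> + upper_Lambda n phi \<alpha>"
proof -
  define near where
    "near t = ennreal (phi (t powr (1 - \<alpha>) * x) / phi x / t ^ (n + 1)) * indicator {0<..<1} t" for t
  define far where "far t = ennreal (phi (t powr (- \<alpha>) * x) / phi x / t ^ (n + 1)) * indicator {1<..} t" for t
  have [measurable]: "(\<lambda>t. phi (t powr \<beta> * x)) \<in> borel_measurable borel" for \<beta>
    by (rule borel_measurable_young[OF phi]) (measurable, use x in simp)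
  have near [measurable]: "near \<in> borel_measurable lborel" unfolding near_def by measurable
  have far [measurable]: "far \<in> borel_measurable lborel" unfolding far_def by measurable
  have "ennreal (phi (min 1 t * t powr (- \<alpha>) * x) / phi x / t ^ (n + 1)) * indicator {0<..} t
      = near t + far t"
    if "t \<noteq> 1" for t
  proof -
    have "t * t powr (- \<alpha>) = t powr (1 - \<alpha>)" if "0 < t"
      using that by (simp add: powr_diff powr_minus divide_inverse)
    then show ?thesis using \<open>t \<noteq> 1\<close> by (simp add: near_def far_def indicator_def min_def)
  qed
  then have "(\<integral>\<^sup>+ t\<in>{0<..}. ennreal (phi (min 1 t * t powr (- \<alpha>) * x) / phi x / t ^ (n + 1)) \<partial>lborel)
      = (\<integral>\<^sup>+ t. near t + far t \<partial>lborel)"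
    using AE_lborel_singleton[of "1::real"] by (intro nn_integral_cong_AE) (auto elim!: eventually_mono)
  also have "\<dots> = (\<integral>\<^sup>+ t. near t \<partial>lborel) + (\<integral>\<^sup>+ t. far t \<partial>lborel)" by (rule nn_integral_add) measurable
  also have "\<dots> \<le> lower_Lambda n phi \<alpha> + upper_Lambda n phi \<alpha>"
    unfolding near_def far_def
    by (intro add_mono set_nn_integral_le_lower_Lambda set_nn_integral_le_upper_Lambda x)
  finally show ?thesis .
qed

lemma cutoff_kernel_scaling:
  fixes \<delta> t lam w :: real
  assumes phi: "young_function phi" and pos: "0 < \<delta>" "0 < t" "0 < lam" "0 < n" and x: "x = \<delta> powr (- \<alpha>) / lam"
  shows "w * \<delta> ^ n * t ^ (n - 1) * (phi (min 1 (\<delta> * t / \<delta>) / lam * (\<delta> * t) powr (- \<alpha>)) / (\<delta> * t) ^ (2 * n))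
    = w * (phi x / \<delta> ^ n) * (phi (min 1 t * t powr (- \<alpha>) * x) / phi x / t ^ (n + 1))"
proof -
  obtain m where "n = Suc m" using pos(4) gr0_conv_Suc by blast
  then have power: "\<delta> ^ n * t ^ (n - 1) / (\<delta> * t) ^ (2 * n) = 1 / (\<delta> ^ n * t ^ (n + 1))"
    using pos by (simp add: power_mult_distrib power_add mult_2_right field_simps)
  define P where "P = phi (min 1 t * t powr (- \<alpha>) * x)"
  have "min 1 (\<delta> * t / \<delta>) / lam * (\<delta> * t) powr (- \<alpha>) = min 1 t * t powr (- \<alpha>) * x"
    using pos by (simp add: x powr_mult mult_ac)
  then have "w * \<delta> ^ n * t ^ (n - 1) * (phi (min 1 (\<delta> * t / \<delta>) / lam * (\<delta> * t) powr (- \<alpha>)) / (\<delta> * t) ^ (2 * n))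
      = w * P * (\<delta> ^ n * t ^ (n - 1) / (\<delta> * t) ^ (2 * n))"
    by (simp add: P_def mult_ac)
  also have "\<dots> = w * (phi x / \<delta> ^ n) * (P / phi x / t ^ (n + 1))"
    unfolding power using young_pos[OF phi, of x] pos by (simp add: x)
  finally show ?thesis unfolding P_def .
qed

lemma besov_kernel_cutoff_integral_le:
  assumes phi: "young_function phi" and \<delta>: "0 < \<delta>" and lam: "0 < lam"
  shows "(\<integral>\<^sup>+ z. besov_kernel \<alpha> phi (min 1 (norm z / \<delta>) / lam) z \<partial>(lborel :: 'a::euclidean_space measure))
    \<le> ennreal (real DIM('a) * unit_ball_vol DIM('a) * (phi (\<delta> powr (- \<alpha>) / lam) / \<delta> ^ DIM('a)))
      * (lower_Lambda DIM('a) phi \<alpha> + upper_Lambda DIM('a) phi \<alpha>)"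
proof -
  let ?n = "DIM('a)" and ?w = "unit_ball_vol (real DIM('a))"
  define x where "x = \<delta> powr (- \<alpha>) / lam"
  have x: "0 < x" using \<delta> lam by (simp add: x_def)
  define c where "c = real ?n * ?w * (phi x / \<delta> ^ ?n)"
  have c: "0 \<le> c" using young_pos[OF phi x] \<delta> by (simp add: c_def)
  define g where "g s = ennreal (phi (min 1 (\<bar>s\<bar> / \<delta>) / lam * \<bar>s\<bar> powr (- \<alpha>)) / \<bar>s\<bar> ^ (2 * ?n))" for s
  have [measurable]: "(\<lambda>s. phi (min 1 (\<bar>s\<bar> / \<delta>) / lam * \<bar>s\<bar> powr (- \<alpha>))) \<in> borel_measurable borel"
    by (rule borel_measurable_young[OF phi]) (measurable, use \<delta> lam in simp)
  have g: "g \<in> borel_measurable borel" unfolding g_def by measurable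
  define h where
    "h t = ennreal (phi (min 1 \<bar>t\<bar> * t powr (- \<alpha>) * x) / phi x / t ^ (?n + 1)) * indicator {0<..} t" for t
  have [measurable]: "(\<lambda>t. phi (min 1 \<bar>t\<bar> * t powr (- \<alpha>) * x)) \<in> borel_measurable borel"
    by (rule borel_measurable_young[OF phi]) (measurable, use x in simp)
  have h: "h \<in> borel_measurable lborel" unfolding h_def by measurable
  have scaled: "ennreal (real ?n * ?w * \<delta> ^ ?n * t ^ (?n - 1)) * g (\<delta> * t) * indicator {0<..} t
      = ennreal c * h t" for t
  proof (cases "0 < t")
    case True
    then have "ennreal (real ?n * ?w * \<delta> ^ ?n * t ^ (?n - 1)) * g (\<delta> * t)
        = ennreal (real ?n * ?w * \<delta> ^ ?n * t ^ (?n - 1)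
            * (phi (min 1 (\<delta> * t / \<delta>) / lam * (\<delta> * t) powr (- \<alpha>)) / (\<delta> * t) ^ (2 * ?n)))"
      using \<delta> by (subst ennreal_mult') (simp_all add: g_def)
    also have "\<dots> = ennreal c * ennreal (phi (min 1 t * t powr (- \<alpha>) * x) / phi x / t ^ (?n + 1))"
      unfolding cutoff_kernel_scaling[OF phi \<delta> True lam DIM_positive x_def] c_def[symmetric]
      by (rule ennreal_mult'[OF c])
    finally show ?thesis using True by (simp add: h_def)
  qed (simp add: h_def)
  have "(\<integral>\<^sup>+ z. besov_kernel \<alpha> phi (min 1 (norm z / \<delta>) / lam) (z::'a) \<partial>lborel)
      = (\<integral>\<^sup>+ z. g (norm (z::'a)) \<partial>lborel)"
    by (simp add: besov_kernel_def g_def)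
  also have "\<dots> = (\<integral>\<^sup>+ t. ennreal c * h t \<partial>lborel)"
    unfolding nn_integral_norm_scaled[OF g \<delta>] scaled ..
  also have "\<dots> = ennreal c * (\<integral>\<^sup>+ t. h t \<partial>lborel)" by (rule nn_integral_cmult[OF h])
  also have "(\<integral>\<^sup>+ t. h t \<partial>lborel)
      = (\<integral>\<^sup>+ t\<in>{0<..}. ennreal (phi (min 1 t * t powr (- \<alpha>) * x) / phi x / t ^ (?n + 1)) \<partial>lborel)"
    by (intro nn_integral_cong) (simp add: h_def indicator_def)
  also have "ennreal c * \<dots> \<le> ennreal c * (lower_Lambda ?n phi \<alpha> + upper_Lambda ?n phi \<alpha>)"
    by (intro mult_left_mono set_nn_integral_cutoff_profile_le[OF phi x]) simp
  finally show ?thesis unfolding c_def x_def .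
qed

definition cutoff :: "'a::metric_space \<Rightarrow> real \<Rightarrow> 'a \<Rightarrow> real" where
  "cutoff x \<delta> y = max 0 (min 1 (2 - dist x y / \<delta>))"

lemma cutoff_eq_1: "0 < \<delta> \<Longrightarrow> dist x y \<le> \<delta> \<Longrightarrow> cutoff x \<delta> y = 1"
  by (simp add: cutoff_def le_diff_eq)

lemma cutoff_eq_0: "0 < \<delta> \<Longrightarrow> 2 * \<delta> \<le> dist x y \<Longrightarrow> cutoff x \<delta> y = 0"
  by (simp add: cutoff_def min_def le_divide_eq)

lemma cutoff_diff_le:
  assumes "0 < \<delta>"
  shows "\<bar>cutoff x \<delta> y - cutoff x \<delta> z\<bar> \<le> min 1 (dist y z / \<delta>)"
proof -
  have "\<bar>dist x y - dist x z\<bar> / \<delta> \<le> dist y z / \<delta>"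
    using assms abs_dist_diff_le[of y x z] by (intro divide_right_mono) (auto simp: dist_commute)
  then have "\<bar>dist x y / \<delta> - dist x z / \<delta>\<bar> \<le> dist y z / \<delta>"
    using assms by (simp add: diff_divide_distrib[symmetric] abs_divide)
  then show ?thesis unfolding cutoff_def by linarith
qed

lemma borel_measurable_cutoff: "cutoff x \<delta> \<in> borel_measurable (borel :: 'a::euclidean_space measure)"
  unfolding cutoff_def by measurable

lemma besov_modular_cutoff_le:
  fixes \<Omega> :: "'a::euclidean_space set"
  assumes phi: "young_function phi" and \<delta>: "0 < \<delta>" and lam: "0 < lam" and \<Omega>: "open \<Omega>"
  shows "besov_modular \<alpha> phi \<Omega> (cutoff x \<delta>) lam
    \<le> 2 * emeasure lborel (ball x (2 * \<delta>) \<inter> \<Omega>) *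
       (ennreal (real DIM('a) * unit_ball_vol DIM('a) * (phi (\<delta> powr (- \<alpha>) / lam) / \<delta> ^ DIM('a)))
        * (lower_Lambda DIM('a) phi \<alpha> + upper_Lambda DIM('a) phi \<alpha>))"
proof -
  define B where "B = ball x (2 * \<delta>) \<inter> \<Omega>"
  define k where "k z = besov_kernel \<alpha> phi (min 1 (norm z / \<delta>) / lam) z" for z :: 'a
  have k: "k \<in> borel_measurable borel"
    unfolding k_def using \<delta> lam by (intro borel_measurable_besov_kernel[OF phi]) auto
  have kernel_le: "besov_kernel \<alpha> phi (\<bar>cutoff x \<delta> y - cutoff x \<delta> z\<bar> / lam) (y - z)
      \<le> (indicator B y + indicator B z) * k (y - z)" if yz: "y \<in> \<Omega>" "z \<in> \<Omega>" for y z
  proof (cases "y \<in> B \<or> z \<in> B")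
    case False
    then have "cutoff x \<delta> y = 0" "cutoff x \<delta> z = 0"
      using yz by (auto simp: B_def not_less intro!: cutoff_eq_0[OF \<delta>])
    then show ?thesis by (simp add: besov_kernel_zero[OF phi])
  next
    case True
    have "besov_kernel \<alpha> phi (\<bar>cutoff x \<delta> y - cutoff x \<delta> z\<bar> / lam) (y - z) \<le> k (y - z)"
      unfolding k_def using cutoff_diff_le[OF \<delta>, of x y z] lam
      by (intro besov_kernel_mono[OF phi] divide_right_mono) (auto simp: dist_norm)
    also have "\<dots> \<le> (indicator B y + indicator B z) * k (y - z)"
      using True by (auto simp: indicator_def mult_2)
    finally show ?thesis .
  qed
  have "besov_modular \<alpha> phi \<Omega> (cutoff x \<delta>) lam
      \<le> (\<integral>\<^sup>+ y. \<integral>\<^sup>+ z. (indicator B y + indicator B z) * k (y - z) \<partial>lborel \<partial>lborel)"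
    unfolding besov_modular_eq_kernel nn_integral_completion
    using kernel_le by (intro nn_integral_mono) (auto simp: indicator_def[of \<Omega>] intro!: nn_integral_mono)
  also have "\<dots> = 2 * emeasure lborel B * (\<integral>\<^sup>+ z. k z \<partial>lborel)"
    using \<Omega> by (intro nn_integral_even_kernel_pairs_meeting k) (auto simp: k_def B_def besov_kernel_def)
  also have "\<dots> \<le> 2 * emeasure lborel B *
      (ennreal (real DIM('a) * unit_ball_vol DIM('a) * (phi (\<delta> powr (- \<alpha>) / lam) / \<delta> ^ DIM('a)))
        * (lower_Lambda DIM('a) phi \<alpha> + upper_Lambda DIM('a) phi \<alpha>))"
    unfolding k_def by (intro mult_left_mono besov_kernel_cutoff_integral_le[OF phi \<delta> lam]) simp
  finally show ?thesis unfolding B_def .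
qed

section \<open>From the embedding to regularity\<close>

lemma measure_le_if_Lp_norm_le:
  assumes p: "0 < p" and t: "0 < t" and M: "0 \<le> M" and S: "S \<in> lmeasurable" "S \<subseteq> \<Omega>"
    and f: "\<And>y. y \<in> S \<Longrightarrow> t \<le> \<bar>f y\<bar>" and Lp: "Lp_norm p \<Omega> f \<le> ennreal M"
  shows "measure lebesgue S \<le> (M / t) powr p"
proof -
  have "ennreal (t powr p * measure lebesgue S) = (\<integral>\<^sup>+ y. ennreal (t powr p) * indicator S y \<partial>lebesgue)"
    using S(1) by (simp add: nn_integral_cmult_indicator fmeasurableD emeasure_eq_measure2 ennreal_mult)
  also have "\<dots> \<le> (\<integral>\<^sup>+ y\<in>\<Omega>. ennreal (\<bar>f y\<bar> powr p) \<partial>lebesgue)"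
    using S(2) f p t by (intro nn_integral_mono) (auto simp: indicator_def intro!: ennreal_leI powr_mono2)
  also have "\<dots> \<le> ennreal (M powr p)" using Lp by (simp add: Lp_norm_le_iff[OF p M])
  finally have "t powr p * measure lebesgue S \<le> M powr p" by simp
  then show ?thesis using t by (simp add: powr_divide field_simps)
qed

text \<open>A constant cannot be close to both values \<open>0\<close> and \<open>1\<close> of the cutoff, and each of them is
  taken on a set of at least the measure of the inner ball.\<close>

lemma measure_ball_le_if_cutoff_near_constant:
  fixes \<Omega> :: "'a::euclidean_space set"
  assumes \<Omega>: "\<Omega> \<in> sets lebesgue" and p: "0 < p" and M: "0 \<le> M" and \<delta>: "0 < \<delta>"
    and Lp: "Lp_norm p \<Omega> (\<lambda>y. cutoff x \<delta> y - c) \<le> ennreal M"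
    and c: "c = 0 \<or> \<Omega> \<in> lmeasurable \<and> 2 * measure lebesgue (ball x (2 * \<delta>) \<inter> \<Omega>) \<le> measure lebesgue \<Omega>"
  shows "measure lebesgue (ball x \<delta> \<inter> \<Omega>) \<le> (2 * M) powr p"
proof -
  define inner outer where "inner = ball x \<delta> \<inter> \<Omega>" and "outer = \<Omega> - ball x (2 * \<delta>) \<inter> \<Omega>"
  have ball: "ball x r \<inter> \<Omega> \<in> lmeasurable" for r
    using \<Omega> by (intro bounded_set_imp_lmeasurable sets.Int) auto
  obtain S where S: "S \<in> lmeasurable" "S \<subseteq> \<Omega>" "measure lebesgue inner \<le> measure lebesgue S"
    and far: "\<And>y. y \<in> S \<Longrightarrow> 1 / 2 \<le> \<bar>cutoff x \<delta> y - c\<bar>"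
  proof (cases "c \<le> 1 / 2")
    case True
    show thesis
    proof (rule that[of inner])
      fix y assume "y \<in> inner"
      then have "cutoff x \<delta> y = 1" by (intro cutoff_eq_1[OF \<delta>]) (simp add: inner_def)
      then show "1 / 2 \<le> \<bar>cutoff x \<delta> y - c\<bar>" using True by simp
    qed (use ball in \<open>auto simp: inner_def\<close>)
  next
    case False
    with c have fin: "\<Omega> \<in> lmeasurable"
      and half: "2 * measure lebesgue (ball x (2 * \<delta>) \<inter> \<Omega>) \<le> measure lebesgue \<Omega>" by auto
    show thesis
    proof (rule that[of outer])
      have "measure lebesgue inner \<le> measure lebesgue (ball x (2 * \<delta>) \<inter> \<Omega>)"
        unfolding inner_def using ball \<delta> by (intro measure_mono_fmeasurable) auto
      also have "\<dots> \<le> measure lebesgue \<Omega> - measure lebesgue (ball x (2 * \<delta>) \<inter> \<Omega>)" using half by simp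
      also have "\<dots> = measure lebesgue outer"
        unfolding outer_def using fin ball by (intro measurable_measure_Diff[symmetric]) auto
      finally show "measure lebesgue inner \<le> measure lebesgue outer" .
      fix y assume "y \<in> outer"
      then have "cutoff x \<delta> y = 0" by (intro cutoff_eq_0[OF \<delta>]) (auto simp: outer_def)
      then show "1 / 2 \<le> \<bar>cutoff x \<delta> y - c\<bar>" using False by simp
    qed (use fin ball in \<open>auto simp: outer_def\<close>)
  qed
  have "measure lebesgue S \<le> (M / (1 / 2)) powr p"
    by (rule measure_le_if_Lp_norm_le[OF p _ M S(1,2) far Lp]) simp
  then show ?thesis using S(3) by (simp add: inner_def mult.commute)
qed

lemma cutoff_in_besov_space:
  fixes \<Omega> :: "'a::euclidean_space set"
  assumes "0 < lam" "besov_modular \<alpha> phi \<Omega> (cutoff x \<delta>) lam \<le> 1"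
  shows "cutoff x \<delta> \<in> besov_space \<alpha> phi \<Omega>" "besov_norm \<alpha> phi \<Omega> (cutoff x \<delta>) \<le> lam"
proof -
  have admissible: "lam \<in> besov_admissible \<alpha> phi \<Omega> (cutoff x \<delta>)"
    using assms by (simp add: besov_admissible_def)
  have "cutoff x \<delta> \<in> borel_measurable (restrict_space lebesgue \<Omega>)"
    using borel_measurable_cutoff by (intro measurable_restrict_space1 measurable_completion) simp
  with admissible show "cutoff x \<delta> \<in> besov_space \<alpha> phi \<Omega>" by (auto simp: besov_space_def)
  have "bdd_below (besov_admissible \<alpha> phi \<Omega> (cutoff x \<delta>))"
    by (rule bdd_belowI[of _ 0]) (simp add: besov_admissible_def)
  with admissible show "besov_norm \<alpha> phi \<Omega> (cutoff x \<delta>) \<le> lam"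
    unfolding besov_norm_def by (rule cInf_lower)
qed

lemma besov_embedding_imp_measure_ball_le:
  fixes \<Omega> :: "'a::euclidean_space set"
  assumes emb: "besov_embedding \<alpha> phi \<Omega> C" and \<alpha>: "\<alpha> \<noteq> 0" and C: "0 \<le> C" and \<Omega>: "open \<Omega>"
    and \<delta>: "0 < \<delta>" and lam: "0 < lam" and modular: "besov_modular \<alpha> phi \<Omega> (cutoff x \<delta>) lam \<le> 1"
    and half: "bounded \<Omega> \<Longrightarrow> 2 * measure lebesgue (ball x (2 * \<delta>) \<inter> \<Omega>) \<le> measure lebesgue \<Omega>"
  shows "measure lebesgue (ball x \<delta> \<inter> \<Omega>) \<le> (2 * (C * lam)) powr (real DIM('a) / \<bar>\<alpha>\<bar>)"
proof -
  let ?u = "cutoff x \<delta>"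
  note space = cutoff_in_besov_space[OF lam modular]
  define c where "c = (if bounded \<Omega> then average \<Omega> ?u else 0)"
  have "y \<in> ball x (2 * \<delta>)" if "?u y \<noteq> 0" for y
    using that cutoff_eq_0[OF \<delta>, of x y] by (metis mem_ball not_le)
  then have "bounded {y\<in>\<Omega>. ?u y \<noteq> 0}" by (intro bounded_subset[OF bounded_ball]) auto
  then have "Lp_norm (real DIM('a) / \<bar>\<alpha>\<bar>) \<Omega> (\<lambda>y. ?u y - c) \<le> ennreal (C * besov_norm \<alpha> phi \<Omega> ?u)"
    using emb space(1) by (auto simp: besov_embedding_def c_def)
  also have "\<dots> \<le> ennreal (C * lam)" using space(2) C by (intro ennreal_leI mult_left_mono)
  finally show ?thesis
    using \<Omega> \<alpha> C \<delta> lam half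
    by (intro measure_ball_le_if_cutoff_near_constant[where c=c]) (auto simp: c_def lmeasurable_open)
qed

text \<open>Near an interior point the density of \<open>\<Omega>\<close> is that of a full ball, so it cannot have been
  small at every dyadic scale.\<close>

lemma measure_ball_ge_if_smallness_halves:
  fixes \<Omega> :: "'a::euclidean_space set"
  assumes \<Omega>: "open \<Omega>" and x: "x \<in> \<Omega>" and r: "0 < r" and \<epsilon>: "\<epsilon> < unit_ball_vol (real DIM('a))"
    and halve: "\<And>\<delta>. \<lbrakk>0 < \<delta>; 2 * \<delta> \<le> r; measure lebesgue (ball x (2 * \<delta>) \<inter> \<Omega>) \<le> \<epsilon> * (2 * \<delta>) ^ DIM('a)\<rbrakk>
      \<Longrightarrow> measure lebesgue (ball x \<delta> \<inter> \<Omega>) \<le> \<epsilon> * \<delta> ^ DIM('a)"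
  shows "\<epsilon> * r ^ DIM('a) \<le> measure lebesgue (ball x r \<inter> \<Omega>)"
proof (rule ccontr)
  assume small: "\<not> ?thesis"
  have iterate: "measure lebesgue (ball x (r / 2 ^ j) \<inter> \<Omega>) \<le> \<epsilon> * (r / 2 ^ j) ^ DIM('a)" for j
  proof (induction j)
    case 0
    then show ?case using small by simp
  next
    case (Suc j)
    define \<delta> where "\<delta> = r / 2 ^ Suc j"
    have \<delta>: "0 < \<delta>" "2 * \<delta> = r / 2 ^ j" using r by (simp_all add: \<delta>_def)
    have "r / 2 ^ j \<le> r / 1" using r by (intro divide_left_mono) auto
    then have "measure lebesgue (ball x \<delta> \<inter> \<Omega>) \<le> \<epsilon> * \<delta> ^ DIM('a)"
      using Suc.IH by (intro halve[OF \<delta>(1)]) (simp_all only: \<delta>(2) div_by_1)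
    then show ?case unfolding \<delta>_def .
  qed
  obtain e where e: "0 < e" "ball x e \<subseteq> \<Omega>" using \<Omega> x unfolding open_contains_ball by blast
  obtain j where "(1 / 2) ^ j < e / r" using real_arch_pow_inv[of "e / r" "1 / 2"] e r by auto
  then have "r / 2 ^ j < e" using r by (simp add: power_divide field_simps)
  then have "ball x (r / 2 ^ j) \<inter> \<Omega> = ball x (r / 2 ^ j)" using e by force
  then have "unit_ball_vol (real DIM('a)) * (r / 2 ^ j) ^ DIM('a) \<le> \<epsilon> * (r / 2 ^ j) ^ DIM('a)"
    using iterate[of j] r by (simp add: content_ball)
  moreover have "0 < (r / 2 ^ j) ^ DIM('a)" using r by simp
  ultimately show False using \<epsilon> by (simp add: mult_le_cancel_right)
qed

lemma besov_embedding_imp_smallness_halves: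
  fixes \<Omega> :: "'a::euclidean_space set"
  assumes phi: "young_function phi" and \<alpha>: "\<alpha> < 0" and emb: "besov_embedding \<alpha> phi \<Omega> C" and C: "0 \<le> C"
    and L: "lower_Lambda DIM('a) phi \<alpha> + upper_Lambda DIM('a) phi \<alpha> = ennreal L" "0 \<le> L"
    and \<Omega>: "open \<Omega>" and s: "0 < s" and \<epsilon>: "\<epsilon> = (2 * C / s) powr (real DIM('a) / \<bar>\<alpha>\<bar>)"
    and phi_s: "2 * real DIM('a) * unit_ball_vol (real DIM('a)) * L * 2 ^ DIM('a) * \<epsilon> * phi s \<le> 1"
    and \<delta>: "0 < \<delta>" and small: "measure lebesgue (ball x (2 * \<delta>) \<inter> \<Omega>) \<le> \<epsilon> * (2 * \<delta>) ^ DIM('a)"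
    and half: "bounded \<Omega> \<Longrightarrow> 2 * measure lebesgue (ball x (2 * \<delta>) \<inter> \<Omega>) \<le> measure lebesgue \<Omega>"
  shows "measure lebesgue (ball x \<delta> \<inter> \<Omega>) \<le> \<epsilon> * \<delta> ^ DIM('a)"
proof -
  let ?n = "DIM('a)" and ?w = "unit_ball_vol (real DIM('a))"
  define m where "m = measure lebesgue (ball x (2 * \<delta>) \<inter> \<Omega>)"
  define lam where "lam = \<delta> powr (- \<alpha>) / s"
  have lam: "0 < lam" "\<delta> powr (- \<alpha>) / lam = s" using \<delta> s by (simp_all add: lam_def)
  have phi0: "0 \<le> phi s" using s by (intro young_nonneg[OF phi]) simp
  have "emeasure lborel (ball x (2 * \<delta>) \<inter> \<Omega>) = emeasure lebesgue (ball x (2 * \<delta>) \<inter> \<Omega>)"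
    using \<Omega> by (subst emeasure_completion) auto
  also have "\<dots> = ennreal m" unfolding m_def using \<Omega> by (intro emeasure_ball_Int) auto
  finally have m: "emeasure lborel (ball x (2 * \<delta>) \<inter> \<Omega>) = ennreal m" .
  have "besov_modular \<alpha> phi \<Omega> (cutoff x \<delta>) lam
      \<le> 2 * ennreal m * (ennreal (real ?n * ?w * (phi s / \<delta> ^ ?n)) * ennreal L)"
    using besov_modular_cutoff_le[OF phi \<delta> lam(1) \<Omega>, of \<alpha> x] unfolding m lam(2) L(1) .
  also have "\<dots> = ennreal (2 * real ?n * ?w * L * (phi s / \<delta> ^ ?n) * m)"
    using phi0 \<delta> L(2)
    by (simp add: m_def ennreal_mult[symmetric] ennreal_numeral[symmetric] mult_ac del: ennreal_numeral)
  also have "\<dots> \<le> 1"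
  proof -
    have "2 * real ?n * ?w * L * (phi s / \<delta> ^ ?n) * m
        \<le> 2 * real ?n * ?w * L * (phi s / \<delta> ^ ?n) * (\<epsilon> * (2 * \<delta>) ^ ?n)"
      using small phi0 \<delta> L(2) by (intro mult_left_mono) (auto simp: m_def)
    also have "\<dots> = 2 * real ?n * ?w * L * 2 ^ ?n * \<epsilon> * phi s" using \<delta> by (simp add: power_mult_distrib)
    finally show ?thesis using phi_s by (simp add: ennreal_le_1)
  qed
  finally have "measure lebesgue (ball x \<delta> \<inter> \<Omega>) \<le> (2 * (C * lam)) powr (real ?n / \<bar>\<alpha>\<bar>)"
    using \<alpha> half by (intro besov_embedding_imp_measure_ball_le[OF emb _ C \<Omega> \<delta> lam(1)]) auto
  also have "2 * (C * lam) = 2 * C / s * \<delta> powr (- \<alpha>)" by (simp add: lam_def)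
  also have "\<dots> powr (real ?n / \<bar>\<alpha>\<bar>) = \<epsilon> * \<delta> ^ ?n"
    unfolding \<epsilon> powr_mult[of "2 * C / s"] using \<delta> \<alpha> by (simp add: powr_powr powr_realpow)
  finally show ?thesis .
qed

lemma half_measure_threshold:
  fixes \<Omega> :: "'a::euclidean_space set"
  assumes \<Omega>: "open \<Omega>" "\<Omega> \<noteq> {}"
  shows "\<exists>\<epsilon>>0. bounded \<Omega> \<longrightarrow> 2 * (\<epsilon> * (2 * diameter \<Omega>) ^ DIM('a)) \<le> measure lebesgue \<Omega>"
proof (cases "bounded \<Omega>")
  case True
  obtain x e where e: "0 < e" "ball x e \<subseteq> \<Omega>" using \<Omega> unfolding open_contains_ball by blast
  have "0 < diameter (ball x e)" using e by simp
  also have "\<dots> \<le> diameter \<Omega>" by (rule diameter_subset[OF e(2) True])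
  finally have diam: "0 < diameter \<Omega>" .
  have "0 < measure lebesgue (ball x e)" using e by (simp add: content_ball)
  also have "\<dots> \<le> measure lebesgue \<Omega>"
    using e \<Omega> True by (intro measure_mono_fmeasurable) (auto intro: lmeasurable_open)
  finally show ?thesis
    using diam by (intro exI[of _ "measure lebesgue \<Omega> / (2 * (2 * diameter \<Omega>) ^ DIM('a))"]) simp
qed (auto intro: zero_less_one)

lemma besov_embedding_imp_globally_regular:
  fixes \<Omega> :: "'a::euclidean_space set"
  assumes phi: "young_function phi" and \<alpha>: "\<alpha> < 0"
    and low: "lower_Lambda DIM('a) phi \<alpha> < \<infinity>" and up: "upper_Lambda DIM('a) phi \<alpha> < \<infinity>"
    and dom: "is_domain \<Omega>" and C: "0 < C" and emb: "besov_embedding \<alpha> phi \<Omega> C"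
  shows "globally_regular \<Omega>"
proof -
  let ?n = "DIM('a)" and ?w = "unit_ball_vol (real DIM('a))"
  have \<Omega>: "open \<Omega>" "\<Omega> \<noteq> {}" using dom by (auto simp: is_domain_def)
  obtain L where L: "lower_Lambda ?n phi \<alpha> + upper_Lambda ?n phi \<alpha> = ennreal L" "0 \<le> L"
    using low up by (cases "lower_Lambda ?n phi \<alpha> + upper_Lambda ?n phi \<alpha>") auto
  obtain \<epsilon>0 where \<epsilon>0: "0 < \<epsilon>0" "bounded \<Omega> \<Longrightarrow> 2 * (\<epsilon>0 * (2 * diameter \<Omega>) ^ ?n) \<le> measure lebesgue \<Omega>"
    using half_measure_threshold[OF \<Omega>] by blast
  define \<mu> where "\<mu> = min \<epsilon>0 (min (?w / 2) (1 / 2))"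
  have \<mu>: "0 < \<mu>" "\<mu> \<le> \<epsilon>0" "\<mu> < ?w" "\<mu> < 1" using \<epsilon>0(1) by (auto simp: \<mu>_def min_def)
  obtain s where s: "0 < s" and "(2 * C / s) powr (real ?n / \<bar>\<alpha>\<bar>) \<le> \<mu>"
    "2 * real ?n * ?w * L * 2 ^ ?n * (2 * C / s) powr (real ?n / \<bar>\<alpha>\<bar>) * phi s \<le> 1"
    using exists_young_times_powr_small[OF phi \<alpha> up DIM_positive _ _ \<mu>(1),
        of "2 * C" "2 * real ?n * ?w * L * 2 ^ ?n"] C L(2) by auto
  moreover define \<epsilon> where "\<epsilon> = (2 * C / s) powr (real ?n / \<bar>\<alpha>\<bar>)"
  ultimately have \<epsilon>: "0 < \<epsilon>" "\<epsilon> \<le> \<mu>" and phi_s: "2 * real ?n * ?w * L * 2 ^ ?n * \<epsilon> * phi s \<le> 1"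
    using C by simp_all
  have "\<epsilon> * r ^ ?n \<le> measure lebesgue (ball x r \<inter> \<Omega>)"
    if x: "x \<in> \<Omega>" and r: "0 < r" "bounded \<Omega> \<longrightarrow> r < 2 * diameter \<Omega>" for x r
  proof (rule measure_ball_ge_if_smallness_halves[OF \<Omega>(1) x r(1)])
    fix \<delta> assume \<delta>: "0 < \<delta>" "2 * \<delta> \<le> r"
      and small: "measure lebesgue (ball x (2 * \<delta>) \<inter> \<Omega>) \<le> \<epsilon> * (2 * \<delta>) ^ ?n"
    have half: "2 * measure lebesgue (ball x (2 * \<delta>) \<inter> \<Omega>) \<le> measure lebesgue \<Omega>" if "bounded \<Omega>"
    proof -
      have "\<epsilon> * (2 * \<delta>) ^ ?n \<le> \<epsilon>0 * (2 * diameter \<Omega>) ^ ?n"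
        using \<epsilon> \<mu>(2) \<delta> r that by (intro mult_mono power_mono) auto
      then show ?thesis using small \<epsilon>0(2)[OF that] by linarith
    qed
    show "measure lebesgue (ball x \<delta> \<inter> \<Omega>) \<le> \<epsilon> * \<delta> ^ ?n"
      by (rule besov_embedding_imp_smallness_halves[OF phi \<alpha> emb less_imp_le[OF C] L \<Omega>(1) s \<epsilon>_def phi_s
            \<delta>(1) small half])
  qed (use \<epsilon> \<mu> in simp)
  moreover have "\<epsilon> < 1" using \<epsilon> \<mu> by simp
  ultimately show ?thesis unfolding globally_regular_def using \<epsilon>(1) by blast
qed

theorem theorem1p2:
  fixes phi :: "real \<Rightarrow> real" and \<alpha> :: real and \<Omega> :: "'a::euclidean_space set"
  assumes "DIM('a) \<ge> 2"
    and "- real DIM('a) < \<alpha>" and "\<alpha> < 0"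
    and "young_function phi"
    and "lower_Lambda DIM('a) phi \<alpha> < \<infinity>"
    and "upper_Lambda DIM('a) phi \<alpha> < \<infinity>"
    and "is_domain \<Omega>"
  shows "globally_regular \<Omega> \<longleftrightarrow>
    (\<exists>C\<ge>1.
       (bounded \<Omega> \<longrightarrow>
          (\<forall>u\<in>besov_space \<alpha> phi \<Omega>.
             Lp_norm (real DIM('a) / \<bar>\<alpha>\<bar>) \<Omega> (\<lambda>x. u x - average \<Omega> u)
               \<le> ennreal (C * besov_norm \<alpha> phi \<Omega> u))) \<and>
       (\<not> bounded \<Omega> \<longrightarrow>
          (\<forall>u\<in>besov_space \<alpha> phi \<Omega>. bounded {x\<in>\<Omega>. u x \<noteq> 0} \<longrightarrow>
             Lp_norm (real DIM('a) / \<bar>\<alpha>\<bar>) \<Omega> u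
               \<le> ennreal (C * besov_norm \<alpha> phi \<Omega> u))))"
  unfolding besov_embedding_def[symmetric]
proof
  assume reg: "globally_regular \<Omega>"
  show "\<exists>C\<ge>1. besov_embedding \<alpha> phi \<Omega> C"
  proof (cases "bounded \<Omega>")
    case True
    then show ?thesis using assms reg by (intro regular_bounded_imp_besov_embedding) auto
  next
    case False
    then show ?thesis using assms reg
      by (intro regular_unbounded_imp_besov_embedding) (auto simp: is_domain_def)
  qed
next
  assume "\<exists>C\<ge>1. besov_embedding \<alpha> phi \<Omega> C"
  then obtain C where "1 \<le> C" "besov_embedding \<alpha> phi \<Omega> C" by blast
  with assms show "globally_regular \<Omega>"
    by (intro besov_embedding_imp_globally_regular[of phi \<alpha> \<Omega> C]) auto
qed

end
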